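(* $\operatorname{Ork}(3,3) = 5$.
   Context: Let $k$ be an algebraically closed field of characteristic $0$. For $n \ge 1$ let $S = k[x_1,\dots,x_n]$ and let $S_d$ be the space of homogeneous polynomials (forms) of degree $d$ in $S$. The space $S_1$ of linear forms is regarded as the affine space $\mathbb{A}^n$ over $k$ with its Zariski topology. A closed subset $V\subsetneq S_1$ is called homogeneous if it is the zero set of a set of homogeneous polynomials, i.e. it is stable under multiplication by scalars (the empty set is allowed). A form $F \in S_d$ essentially depends on $n$ variables if it cannot be written using fewer than $n$ variables after a linear change of coordinates. For $F \in S_d$ and $V \subseteq S_1$, let $\operatorname{Ork}(F,V)$ be the minimal natural number $m$ such that there is a presentation $F = \sum_{i=1}^m l_i^d$ with all $l_i \in S_1 \setminus V$, and $\operatorname{Ork}(F,V) = \infty$ if no such presentation exists. The open Waring rank of $F$ is \[ \operatorname{Ork}(F) = \sup\{\operatorname{Ork}(F,V) \mid V \subsetneq S_1 \text{ homogeneous and Zariski closed}\}, \] and \[ \operatorname{Ork}(n,d) = \sup\{\operatorname{Ork}(F) \mid F \in S_d \text{ essentially depends on } n \text{ variables}\}, \] where $S = k[x_1,\dots,x_n]$. *)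

theory Defs
  imports
    "HOL-Library.Poly_Mapping"
    "HOL-Library.Extended_Nat"
    "HOL-Computational_Algebra.Polynomial"
begin

(* Monomials are finitely supported exponent vectors; the ring operations on the outer
   type are those of the monoid algebra, i.e. of the polynomial ring.
   k[x_1,...,x_n] is the subring in the indeterminates with index in {..<n}. *)

type_synonym 'k mpoly = "(nat \<Rightarrow>\<^sub>0 nat) \<Rightarrow>\<^sub>0 'k"

definition Const :: "'k::zero \<Rightarrow> 'k mpoly" where
  "Const c = Poly_Mapping.single 0 c"

definition Var :: "nat \<Rightarrow> 'k::zero_neq_one mpoly" where
  "Var i = Poly_Mapping.single (Poly_Mapping.single i 1) 1"

definition vars :: "'k::zero mpoly \<Rightarrow> nat set" where
  "vars p = (\<Union>m\<in>Poly_Mapping.keys p. Poly_Mapping.keys m)"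

definition mon_degree :: "(nat \<Rightarrow>\<^sub>0 nat) \<Rightarrow> nat" where
  "mon_degree m = (\<Sum>i\<in>Poly_Mapping.keys m. Poly_Mapping.lookup m i)"

definition polys :: "nat \<Rightarrow> 'k::zero mpoly set" where
  "polys n = {p. vars p \<subseteq> {..<n}}"

(* The space S_d; it contains the zero polynomial. *)
definition forms :: "nat \<Rightarrow> nat \<Rightarrow> 'k::zero mpoly set" where
  "forms n d = {p \<in> polys n. \<forall>m\<in>Poly_Mapping.keys p. mon_degree m = d}"

definition eval :: "(nat \<Rightarrow> 'k::comm_semiring_1) \<Rightarrow> 'k mpoly \<Rightarrow> 'k" where
  "eval a p = (\<Sum>m\<in>Poly_Mapping.keys p.
     Poly_Mapping.lookup p m * (\<Prod>i\<in>Poly_Mapping.keys m. a i ^ Poly_Mapping.lookup m i))"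

definition subst :: "(nat \<Rightarrow> 'k::comm_semiring_1 mpoly) \<Rightarrow> 'k mpoly \<Rightarrow> 'k mpoly" where
  "subst g p = (\<Sum>m\<in>Poly_Mapping.keys p.
     Const (Poly_Mapping.lookup p m) * (\<Prod>i\<in>Poly_Mapping.keys m. g i ^ Poly_Mapping.lookup m i))"

(* S_1 is identified with affine n-space through the coefficients of a linear form. *)
definition lin_coord :: "'k::zero mpoly \<Rightarrow> nat \<Rightarrow> 'k" where
  "lin_coord l i = Poly_Mapping.lookup l (Poly_Mapping.single i 1)"

definition zero_locus :: "nat \<Rightarrow> 'k::comm_semiring_1 mpoly set \<Rightarrow> 'k mpoly set" where
  "zero_locus n P = {l \<in> forms n 1. \<forall>p\<in>P. eval (lin_coord l) p = 0}"

definition zariski_closed :: "nat \<Rightarrow> 'k::comm_semiring_1 mpoly set \<Rightarrow> bool" where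
  "zariski_closed n V \<longleftrightarrow> (\<exists>P \<subseteq> polys n. V = zero_locus n P)"

definition homogeneous_locus :: "nat \<Rightarrow> 'k::comm_semiring_1 mpoly set \<Rightarrow> bool" where
  "homogeneous_locus n V \<longleftrightarrow> (\<exists>P \<subseteq> (\<Union>e. forms n e). V = zero_locus n P)"

(* g i is the linear form replacing the i-th variable; h is the inverse substitution. *)
definition linear_change :: "nat \<Rightarrow> (nat \<Rightarrow> 'k::comm_semiring_1 mpoly) \<Rightarrow> bool" where
  "linear_change n g \<longleftrightarrow> (\<forall>i<n. g i \<in> forms n 1) \<and>
     (\<exists>h. (\<forall>i<n. h i \<in> forms n 1) \<and>
          (\<forall>i<n. subst h (g i) = Var i \<and> subst g (h i) = Var i))"

definition essentially_depends :: "nat \<Rightarrow> 'k::comm_semiring_1 mpoly \<Rightarrow> bool" where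
  "essentially_depends n F \<longleftrightarrow> \<not> (\<exists>g. linear_change n g \<and> card (vars (subst g F)) < n)"

(* The infimum of the empty set in enat is infinity. *)
definition Ork_avoiding ::
  "nat \<Rightarrow> nat \<Rightarrow> 'k::comm_semiring_1 mpoly \<Rightarrow> 'k mpoly set \<Rightarrow> enat" where
  "Ork_avoiding n d F V =
     (INF m \<in> {m. \<exists>l. (\<forall>i<m. l i \<in> forms n 1 - V) \<and> F = (\<Sum>i<m. l i ^ d)}. enat m)"

definition Ork_form :: "nat \<Rightarrow> nat \<Rightarrow> 'k::comm_semiring_1 mpoly \<Rightarrow> enat" where
  "Ork_form n d F =
     (SUP V \<in> {V. V \<subset> forms n 1 \<and> homogeneous_locus n V \<and> zariski_closed n V}.
        Ork_avoiding n d F V)"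

definition Ork :: "'k::comm_semiring_1 itself \<Rightarrow> nat \<Rightarrow> nat \<Rightarrow> enat" where
  "Ork _ n d =
     (SUP F \<in> {F :: 'k mpoly. F \<in> forms n d \<and> essentially_depends n F}. Ork_form n d F)"

end

theory Submission
  imports Defs
begin

text \<open>
  Write a cubic form as \<open>F(a) = T a a a\<close> with \<open>T\<close> symmetric and trilinear,
  and identify a linear form with its vector of coefficients.

  Upper bound. The linear forms to be avoided satisfy an equation \<open>\<psi> = 0\<close> with
  \<open>\<psi>\<close> homogeneous and nonzero. Choose vectors \<open>v, w\<close> in general
  position and put \<open>l = T v w\<close>, a linear form. For \<open>t = 1 / (l(v) l(w))\<close>
  the cubic \<open>F - t l\<^sup>3\<close> is annihilated by the product of the derivatives along
  \<open>v\<close> and \<open>w\<close>, so it is a sum of two binary cubics, one in the linear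
  forms vanishing on \<open>w\<close> and one in those vanishing on \<open>v\<close>. These two
  planes of linear forms share the line spanned by \<open>m = v \<times> w\<close>, so a multiple of
  \<open>m\<^sup>3\<close> can be moved from one binary cubic to the other. This parameter is what
  makes two cubes enough on each side: for all but finitely many multiples, a binary cubic that
  satisfies three open conditions is a sum of two cubes that avoid \<open>\<psi> = 0\<close>
  (\<open>binary_cubic_two_cubes\<close>). Together \<open>F\<close> is a sum of
  \<open>1 + 2 + 2\<close> cubes (\<open>sum_of_five_cubes\<close>).

  The conditions on \<open>v, w\<close> say that certain polynomials in their coordinates do not
  vanish, and by \<open>polyfun2_common_nonzero\<close> it suffices that each of them is not
  identically zero. This is where essential dependence on three variables enters. It means that no
  nonzero vector is in the kernel of \<open>T\<close>, so that by Hesse's theorem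
  (\<open>hessian_zero_imp_kernel\<close>) there is a vector \<open>v\<close> for which the
  quadratic form \<open>T v\<close> is nondegenerate.

  Lower bound. The Fermat cubic \<open>x\<^sup>3 + y\<^sup>3 + z\<^sup>3\<close> is a sum of three
  cubes, but not of four or fewer cubes of linear forms that all have a nonzero coefficient of
  \<open>z\<close>. The squares of the variables and the products \<open>z x\<close>,
  \<open>z y\<close>, evaluated at the summands, would give five linearly dependent vectors, and the
  coefficients of the cubic exclude such a dependence
  (\<open>fermat_cubic_needs_five_cubes\<close>).
\<close>

section \<open>Evaluation and substitution as homomorphisms\<close>

text \<open>
  Evaluation at a point and substitution of polynomials are two cases of one construction: a ring
  homomorphism on the coefficients together with values for the indeterminates. Multiplicativity
  then needs to be shown only once.
\<close>
definition insertion ::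
  "('k::zero \<Rightarrow> 'r::comm_semiring_1) \<Rightarrow> (nat \<Rightarrow> 'r) \<Rightarrow> 'k mpoly \<Rightarrow> 'r" where
  "insertion \<phi> g p = (\<Sum>m\<in>Poly_Mapping.keys p.
     \<phi> (Poly_Mapping.lookup p m) * (\<Prod>i\<in>Poly_Mapping.keys m. g i ^ Poly_Mapping.lookup m i))"

lemma eval_eq_insertion: "eval a = insertion (\<lambda>c. c) a"
  by (rule ext) (simp add: eval_def insertion_def)

lemma subst_eq_insertion: "subst g = insertion Const g"
  by (rule ext) (simp add: subst_def insertion_def)

lemma monomial_value_add:
  fixes g :: "nat \<Rightarrow> 'r::comm_semiring_1"
  shows "(\<Prod>i\<in>Poly_Mapping.keys (m + m'). g i ^ Poly_Mapping.lookup (m + m') i) =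
    (\<Prod>i\<in>Poly_Mapping.keys m. g i ^ Poly_Mapping.lookup m i) *
    (\<Prod>i\<in>Poly_Mapping.keys m'. g i ^ Poly_Mapping.lookup m' i)"
proof -
  let ?K = "Poly_Mapping.keys m \<union> Poly_Mapping.keys m'"
  have *: "(\<Prod>i\<in>Poly_Mapping.keys n. g i ^ Poly_Mapping.lookup n i) =
      (\<Prod>i\<in>?K. g i ^ Poly_Mapping.lookup n i)"
    if "Poly_Mapping.keys n \<subseteq> ?K" for n
    by (rule prod.mono_neutral_left) (use that in \<open>auto simp: in_keys_iff\<close>)
  show ?thesis
    using Poly_Mapping.keys_add[of m m']
    by (subst (1 2 3) *) (auto simp: lookup_add power_add prod.distrib)
qed

lemma sum_of_monomials:
  "(\<Sum>m\<in>Poly_Mapping.keys p. Poly_Mapping.single m (Poly_Mapping.lookup p m)) = p"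
proof (rule poly_mapping_eqI)
  fix k
  show "Poly_Mapping.lookup (\<Sum>m\<in>Poly_Mapping.keys p.
      Poly_Mapping.single m (Poly_Mapping.lookup p m)) k = Poly_Mapping.lookup p k"
    by (simp add: lookup_sum lookup_single when_def in_keys_iff)
qed

lemma mpoly_induct [case_names zero add single]:
  assumes "P 0" and "\<And>p q. P p \<Longrightarrow> P q \<Longrightarrow> P (p + q)"
    and "\<And>m c. P (Poly_Mapping.single m c)"
  shows "P (p :: 'a \<Rightarrow>\<^sub>0 'b::comm_monoid_add)"
proof -
  have "P (\<Sum>m\<in>K. Poly_Mapping.single m (Poly_Mapping.lookup p m))" if "finite K" for K
    using that by induction (auto intro: assms)
  from this[of "Poly_Mapping.keys p"] show ?thesis
    by (simp add: sum_of_monomials)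
qed

locale coefficient_map =
  fixes \<phi> :: "'k::comm_semiring_1 \<Rightarrow> 'r::comm_semiring_1"
  assumes zero: "\<phi> 0 = 0" and one: "\<phi> 1 = 1"
    and add: "\<phi> (a + b) = \<phi> a + \<phi> b" and mult: "\<phi> (a * b) = \<phi> a * \<phi> b"
begin

lemma insertion_zero: "insertion \<phi> g 0 = 0"
  by (simp add: insertion_def)

lemma insertion_single:
  "insertion \<phi> g (Poly_Mapping.single m c) =
    \<phi> c * (\<Prod>i\<in>Poly_Mapping.keys m. g i ^ Poly_Mapping.lookup m i)"
  by (cases "c = 0") (auto simp: insertion_def zero)

lemma insertion_add: "insertion \<phi> g (p + q) = insertion \<phi> g p + insertion \<phi> g q"
proof -
  let ?K = "Poly_Mapping.keys p \<union> Poly_Mapping.keys q"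
  have *: "insertion \<phi> g r = (\<Sum>m\<in>?K. \<phi> (Poly_Mapping.lookup r m) *
      (\<Prod>i\<in>Poly_Mapping.keys m. g i ^ Poly_Mapping.lookup m i))"
    if "Poly_Mapping.keys r \<subseteq> ?K" for r
    unfolding insertion_def
    by (rule sum.mono_neutral_left) (use that in \<open>auto simp: in_keys_iff zero\<close>)
  show ?thesis
    using Poly_Mapping.keys_add[of p q]
    by (subst (1 2 3) *) (auto simp: lookup_add add sum.distrib distrib_right)
qed

lemma insertion_mult: "insertion \<phi> g (p * q) = insertion \<phi> g p * insertion \<phi> g q"
proof (induction p rule: mpoly_induct)
  case (single m c)
  show ?case
  proof (induction q rule: mpoly_induct)
    case (add p q)
    then show ?case by (simp add: insertion_add distrib_left)
  qed (simp_all add: insertion_zero insertion_single mult_single monomial_value_add mult mult_ac)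
qed (simp_all add: insertion_zero insertion_add distrib_right)

lemma insertion_one: "insertion \<phi> g 1 = 1"
  unfolding single_one[symmetric] insertion_single by (simp add: one)

lemma insertion_power: "insertion \<phi> g (p ^ n) = insertion \<phi> g p ^ n"
  by (induction n) (simp_all add: insertion_one insertion_mult)

lemma insertion_sum: "insertion \<phi> g (\<Sum>i\<in>I. p i) = (\<Sum>i\<in>I. insertion \<phi> g (p i))"
  by (induction I rule: infinite_finite_induct) (simp_all add: insertion_zero insertion_add)

lemma insertion_Const: "insertion \<phi> g (Const c) = \<phi> c"
  by (simp add: Const_def insertion_single)

lemma insertion_Var: "insertion \<phi> g (Var i) = g i"
  by (simp add: Var_def insertion_single one)

lemmas insertion_simps = insertion_zero insertion_one insertion_add insertion_mult
  insertion_power insertion_sum insertion_Const insertion_Var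

end

lemma Const_zero: "Const 0 = 0"
  by (simp add: Const_def)

lemma Const_one: "Const 1 = 1"
  by (simp add: Const_def)

lemma Const_add: "Const (a + b) = Const a + Const b"
  by (simp add: Const_def single_add)

lemma Const_mult: "Const (a * b) = Const a * Const b"
  by (simp add: Const_def mult_single)

lemma Const_sum: "Const (\<Sum>i\<in>I. f i) = (\<Sum>i\<in>I. Const (f i))"
  by (induction I rule: infinite_finite_induct) (simp_all add: Const_zero Const_add)

interpretation eval_hom: coefficient_map "\<lambda>c::'k::comm_semiring_1. c"
  by standard auto

interpretation subst_hom: coefficient_map "Const :: 'k::comm_semiring_1 \<Rightarrow> 'k mpoly"
  by standard (simp_all add: Const_zero Const_one Const_add Const_mult)

lemmas eval_simps = eval_hom.insertion_simps[folded eval_eq_insertion]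
lemmas subst_simps = subst_hom.insertion_simps[folded subst_eq_insertion]

lemma eval_subst: "eval a (subst g p) = eval (\<lambda>i. eval a (g i)) p"
proof (induction p rule: mpoly_induct)
  case (single m c)
  have "eval a (\<Prod>i\<in>K. g i ^ Poly_Mapping.lookup m i) =
      (\<Prod>i\<in>K. eval a (g i) ^ Poly_Mapping.lookup m i)" if "finite K" for K
    using that by induction (simp_all add: eval_simps)
  then show ?case
    by (simp add: subst_eq_insertion subst_hom.insertion_single eval_simps)
      (simp add: eval_eq_insertion eval_hom.insertion_single)
qed (simp_all add: eval_simps subst_simps)

lemma eval_cong:
  assumes "\<And>i. i \<in> vars p \<Longrightarrow> a i = b i"
  shows "eval a p = eval b p"
  unfolding eval_def
proof (intro sum.cong refl arg_cong2[where f = "(*)"] prod.cong)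
  fix m i assume "m \<in> Poly_Mapping.keys p" "i \<in> Poly_Mapping.keys m"
  then have "i \<in> vars p" by (auto simp: vars_def)
  then show "a i ^ Poly_Mapping.lookup m i = b i ^ Poly_Mapping.lookup m i"
    using assms by simp
qed

section \<open>Variables and degrees\<close>

lemma vars_add: "vars (p + q) \<subseteq> vars p \<union> vars q"
  using Poly_Mapping.keys_add[of p q] by (fastforce simp: vars_def)

lemma vars_mult: "vars (p * q) \<subseteq> vars p \<union> vars (q :: 'k::comm_semiring_1 mpoly)"
proof
  fix i assume "i \<in> vars (p * q)"
  then obtain m where m: "m \<in> Poly_Mapping.keys (p * q)" "i \<in> Poly_Mapping.keys m"
    by (auto simp: vars_def)
  from m(1) obtain a b where "a \<in> Poly_Mapping.keys p" "b \<in> Poly_Mapping.keys q" "m = a + b"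
    using keys_mult[of p q] by blast
  with m(2) Poly_Mapping.keys_add[of a b] show "i \<in> vars p \<union> vars q"
    by (auto simp: vars_def)
qed

lemma vars_Const: "vars (Const c) = {}"
  by (auto simp: vars_def Const_def split: if_splits)

lemma vars_Var: "vars (Var i) = {i}"
  by (auto simp: vars_def Var_def)

lemma vars_sum_subset: "(\<And>i. i \<in> I \<Longrightarrow> vars (f i) \<subseteq> A) \<Longrightarrow> vars (\<Sum>i\<in>I. f i) \<subseteq> A"
proof (induction I rule: infinite_finite_induct)
  case (insert x F)
  then show ?case using vars_add[of "f x" "sum f F"] by simp blast
qed (auto simp: vars_def)

lemma vars_mult_subset:
  "vars p \<subseteq> A \<Longrightarrow> vars q \<subseteq> A \<Longrightarrow> vars (p * q :: 'k::comm_semiring_1 mpoly) \<subseteq> A"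
  using vars_mult[of p q] by blast

lemma finite_vars: "finite (vars p)"
  by (simp add: vars_def)

lemma mon_degree_eq_sum:
  "finite K \<Longrightarrow> Poly_Mapping.keys m \<subseteq> K \<Longrightarrow> mon_degree m = (\<Sum>i\<in>K. Poly_Mapping.lookup m i)"
  unfolding mon_degree_def by (rule sum.mono_neutral_left) (auto simp: in_keys_iff)

lemma mon_degree_add: "mon_degree (m + m') = mon_degree m + mon_degree m'"
proof -
  let ?K = "Poly_Mapping.keys m \<union> Poly_Mapping.keys m'"
  show ?thesis
    using Poly_Mapping.keys_add[of m m']
    by (subst (1 2 3) mon_degree_eq_sum[of ?K]) (auto simp: lookup_add sum.distrib)
qed

lemma mon_degree_single: "mon_degree (Poly_Mapping.single i k) = k"
  by (simp add: mon_degree_def)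

lemma zero_in_forms: "0 \<in> forms n d"
  by (simp add: forms_def polys_def vars_def)

lemma forms_add: "p \<in> forms n d \<Longrightarrow> q \<in> forms n d \<Longrightarrow> p + q \<in> forms n d"
  using Poly_Mapping.keys_add[of p q] vars_add[of p q] by (fastforce simp: forms_def polys_def)

lemma forms_sum: "(\<And>i. i \<in> I \<Longrightarrow> f i \<in> forms n d) \<Longrightarrow> (\<Sum>i\<in>I. f i) \<in> forms n d"
  by (induction I rule: infinite_finite_induct) (auto simp: zero_in_forms forms_add)

lemma forms_mult:
  fixes p q :: "'k::comm_semiring_1 mpoly"
  assumes "p \<in> forms n d" "q \<in> forms n e"
  shows "p * q \<in> forms n (d + e)"
proof -
  have "mon_degree m = d + e" if "m \<in> Poly_Mapping.keys (p * q)" for m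
    using that keys_mult[of p q] assms by (fastforce simp: forms_def mon_degree_add)
  then show ?thesis
    using vars_mult[of p q] assms by (auto simp: forms_def polys_def)
qed

lemma Const_in_forms: "Const c \<in> forms n 0"
  by (auto simp: forms_def polys_def vars_Const) (auto simp: Const_def mon_degree_def split: if_splits)

lemma Var_in_forms: "i < n \<Longrightarrow> Var i \<in> forms n 1"
  by (auto simp: forms_def polys_def vars_Var) (auto simp: Var_def mon_degree_single)

lemma forms_power: "(p :: 'k::comm_semiring_1 mpoly) \<in> forms n d \<Longrightarrow> p ^ k \<in> forms n (k * d)"
  using Const_in_forms[of "1::'k" n] by (induction k) (auto simp: Const_one intro: forms_mult)

lemma eval_scale:
  assumes "p \<in> forms n d"
  shows "eval (\<lambda>i. c * a i) p = c ^ d * eval a (p :: 'k::comm_semiring_1 mpoly)"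
proof -
  have "(\<Prod>i\<in>Poly_Mapping.keys m. (c * a i) ^ Poly_Mapping.lookup m i) =
      c ^ d * (\<Prod>i\<in>Poly_Mapping.keys m. a i ^ Poly_Mapping.lookup m i)"
    if "m \<in> Poly_Mapping.keys p" for m
    using that assms
    by (auto simp: power_mult_distrib prod.distrib forms_def mon_degree_def simp flip: power_sum)
  then show ?thesis
    by (simp add: eval_def sum_distrib_left mult_ac)
qed

section \<open>Linear and cubic forms in coordinates\<close>

text \<open>
  The inverse of \<open>lin_coord\<close>: from a coordinate vector to the linear form. It lets all
  later arguments speak about vectors instead of polynomials.
\<close>
definition linear_form :: "nat \<Rightarrow> (nat \<Rightarrow> 'k) \<Rightarrow> 'k::comm_semiring_1 mpoly" where
  "linear_form n a = (\<Sum>i<n. Const (a i) * Var i)"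

lemma linear_form_in_forms: "linear_form n a \<in> forms n 1"
  unfolding linear_form_def using forms_mult[OF Const_in_forms Var_in_forms]
  by (auto intro!: forms_sum)

lemma Const_mult_Var: "Const c * Var i = Poly_Mapping.single (Poly_Mapping.single i 1) (c::'k::comm_semiring_1)"
  by (simp add: Const_def Var_def mult_single)

lemma single_one_eq_iff: "Poly_Mapping.single i (Suc 0) = Poly_Mapping.single j (Suc 0) \<longleftrightarrow> i = j"
  by (metis Zero_not_Suc lookup_single_eq lookup_single_not_eq)

lemma lin_coord_linear_form: "lin_coord (linear_form n a) i = (if i < n then a i else 0)"
  unfolding lin_coord_def linear_form_def Const_mult_Var
  by (simp add: lookup_sum lookup_single when_def single_one_eq_iff)

lemma degree_one_monomial:
  assumes "mon_degree m = 1"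
  obtains i where "m = Poly_Mapping.single i 1"
proof -
  have "(\<Sum>i\<in>Poly_Mapping.keys m. Poly_Mapping.lookup m i) = 1"
    using assms by (simp add: mon_degree_def)
  then obtain i where i: "i \<in> Poly_Mapping.keys m" "Poly_Mapping.lookup m i = 1"
      and z: "\<forall>j\<in>Poly_Mapping.keys m. i \<noteq> j \<longrightarrow> Poly_Mapping.lookup m j = 0"
    using sum_eq_1_iff[OF finite_keys, of "Poly_Mapping.lookup m" m] by auto
  have "m = Poly_Mapping.single i 1"
    by (rule poly_mapping_eqI) (use i z in \<open>auto simp: lookup_single when_def in_keys_iff\<close>)
  then show ?thesis by (rule that)
qed

lemma form_1_eq_linear_form:
  assumes "l \<in> forms n 1"
  shows "l = linear_form n (lin_coord l)"
proof (rule poly_mapping_eqI)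
  fix m
  have rhs: "Poly_Mapping.lookup (linear_form n (lin_coord l)) m =
      (\<Sum>i<n. Poly_Mapping.lookup l (Poly_Mapping.single i 1) when Poly_Mapping.single i 1 = m)"
    unfolding linear_form_def Const_mult_Var by (simp add: lookup_sum lookup_single lin_coord_def)
  show "Poly_Mapping.lookup l m = Poly_Mapping.lookup (linear_form n (lin_coord l)) m"
  proof (cases "m \<in> Poly_Mapping.keys l")
    case True
    then have "mon_degree m = 1" using assms by (auto simp: forms_def)
    then obtain i where m: "m = Poly_Mapping.single i 1" by (rule degree_one_monomial)
    have "i \<in> vars l" using True m by (force simp: vars_def)
    then have "i < n" using assms by (auto simp: forms_def polys_def)
    then show ?thesis by (subst rhs) (simp add: m when_def single_one_eq_iff)
  next
    case False
    then have "(Poly_Mapping.lookup l (Poly_Mapping.single i 1) when Poly_Mapping.single i 1 = m) = 0"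
      for i by (auto simp: in_keys_iff when_def)
    with False show ?thesis unfolding rhs by (simp only: in_keys_iff sum.neutral_const) simp
  qed
qed

lemma eval_linear_form: "eval a (linear_form n b) = (\<Sum>i<n. b i * a i)"
  by (simp add: linear_form_def eval_simps)

text \<open>
  The coefficient array is redundant, since several index triples give the same monomial. This
  redundancy is wanted: in characteristic zero, the arrays of a given form include a symmetric one,
  which is its polar trilinear form.
\<close>
definition cubic :: "nat \<Rightarrow> (nat \<Rightarrow> nat \<Rightarrow> nat \<Rightarrow> 'k) \<Rightarrow> 'k::comm_semiring_1 mpoly" where
  "cubic n c = (\<Sum>i<n. \<Sum>j<n. \<Sum>k<n. Const (c i j k) * (Var i * Var j * Var k))"

lemma cubic_cong:
  "(\<And>i j k. i < n \<Longrightarrow> j < n \<Longrightarrow> k < n \<Longrightarrow> c i j k = d i j k) \<Longrightarrow> cubic n c = cubic n d"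
  by (simp add: cubic_def)

lemma cubic_add: "cubic n (\<lambda>i j k. c i j k + d i j k) = cubic n c + cubic n d"
  by (simp add: cubic_def Const_add distrib_right sum.distrib)

lemma cubic_sum: "cubic n (\<lambda>i j k. \<Sum>r\<in>R. c r i j k) = (\<Sum>r\<in>R. cubic n (c r))"
proof (induction R rule: infinite_finite_induct)
  case (insert x F)
  then show ?case by (simp add: cubic_add)
qed (simp_all add: cubic_def Const_zero)

lemma linear_form_cubed: "linear_form n a ^ 3 = cubic n (\<lambda>i j k. a i * a j * a k)"
proof -
  have "linear_form n a ^ 3 = (\<Sum>i<n. \<Sum>j<n. \<Sum>k<n.
      (Const (a i) * Var i) * ((Const (a j) * Var j) * (Const (a k) * Var k)))"
    unfolding power3_eq_cube mult.assoc unfolding linear_form_def sum_product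
    unfolding sum_distrib_left by (simp only: mult.assoc)
  then show ?thesis
    by (simp add: cubic_def Const_mult mult_ac)
qed

lemma cubic_single:
  assumes "i < n" "j < n" "k < n"
  shows "cubic n (\<lambda>i' j' k'. if i' = i \<and> j' = j \<and> k' = k then c else 0) =
    Const c * (Var i * Var j * Var k)"
proof -
  have "cubic n (\<lambda>i' j' k'. if i' = i \<and> j' = j \<and> k' = k then c else 0) =
     (\<Sum>i'<n. \<Sum>j'<n. \<Sum>k'<n. if k' = k then if j' = j then if i' = i then
        Const c * (Var i * Var j * Var k) else 0 else 0 else 0)"
    unfolding cubic_def by (intro sum.cong refl) (auto simp: Const_zero)
  also have "\<dots> = Const c * (Var i * Var j * Var k)"
    using assms by simp
  finally show ?thesis .
qed

lemma cubic_permute: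
  fixes c :: "nat \<Rightarrow> nat \<Rightarrow> nat \<Rightarrow> 'k::comm_semiring_1"
  shows "cubic n (\<lambda>i j k. c j i k) = cubic n c" and "cubic n (\<lambda>i j k. c i k j) = cubic n c"
proof -
  show "cubic n (\<lambda>i j k. c j i k) = cubic n c"
    unfolding cubic_def by (subst sum.swap) (simp add: mult_ac)
  have "(\<Sum>j<n. \<Sum>k<n. Const (c i k j) * (Var i * Var j * Var k)) =
      (\<Sum>j<n. \<Sum>k<n. Const (c i j k) * (Var i * Var j * Var k))" for i
    by (subst sum.swap) (simp add: mult_ac)
  then show "cubic n (\<lambda>i j k. c i k j) = cubic n c"
    unfolding cubic_def by simp
qed

lemma monomial_split:
  assumes "mon_degree m = Suc d"
  obtains i m' where "m = Poly_Mapping.single i 1 + m'" "mon_degree m' = d"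
proof -
  have "m \<noteq> 0" using assms by (auto simp: mon_degree_def)
  then obtain i where i: "Poly_Mapping.lookup m i \<noteq> 0"
    by (metis lookup_zero poly_mapping_eqI)
  have eq: "m = Poly_Mapping.single i 1 + (m - Poly_Mapping.single i 1)"
    by (rule poly_mapping_eqI) (use i in \<open>auto simp: lookup_add lookup_minus lookup_single when_def\<close>)
  have "mon_degree (m - Poly_Mapping.single i 1) = d"
    using assms arg_cong[OF eq, of mon_degree] by (simp add: mon_degree_add mon_degree_single)
  with eq show ?thesis by (rule that)
qed

lemma form_3_monomial:
  assumes deg: "mon_degree m = 3" and K: "Poly_Mapping.keys m \<subseteq> {..<n}"
  shows "\<exists>d. Poly_Mapping.single m c = cubic n d"
proof -
  obtain i m1 where 1: "m = Poly_Mapping.single i 1 + m1" "mon_degree m1 = 2"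
    using monomial_split[of m 2] deg by (auto simp: eval_nat_numeral)
  obtain j m2 where 2: "m1 = Poly_Mapping.single j 1 + m2" "mon_degree m2 = 1"
    using monomial_split[of m1 1] 1 by (auto simp: eval_nat_numeral)
  obtain k where 3: "m2 = Poly_Mapping.single k 1"
    using 2 degree_one_monomial by blast
  have "{i, j, k} \<subseteq> Poly_Mapping.keys m"
    unfolding 1 2 3 by (auto simp: in_keys_iff lookup_add lookup_single when_def)
  then have "i < n" "j < n" "k < n" using K by auto
  moreover have "Poly_Mapping.single m c = Const c * (Var i * Var j * Var k)"
    unfolding 1 2 3 by (simp add: Const_def Var_def mult_single add.assoc)
  ultimately show ?thesis using cubic_single[of i n j k c] by metis
qed

lemma form_3_eq_cubic:
  assumes "F \<in> forms n 3"
  shows "\<exists>c. F = cubic n c"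
proof -
  have "\<exists>c. (\<Sum>m\<in>K. Poly_Mapping.single m (Poly_Mapping.lookup F m)) = cubic n c"
    if "finite K" "K \<subseteq> Poly_Mapping.keys F" for K
    using that
  proof (induction K)
    case empty
    have "cubic n (\<lambda>i j k. 0) = 0" by (simp add: cubic_def Const_zero)
    then show ?case by (metis sum.empty)
  next
    case (insert m K)
    have "mon_degree m = 3" "Poly_Mapping.keys m \<subseteq> {..<n}"
      using insert.prems assms by (auto simp: forms_def polys_def vars_def)
    then obtain d where "Poly_Mapping.single m (Poly_Mapping.lookup F m) = cubic n d"
      using form_3_monomial by blast
    moreover obtain c where "(\<Sum>m\<in>K. Poly_Mapping.single m (Poly_Mapping.lookup F m)) = cubic n c"
      using insert by auto
    ultimately have "(\<Sum>m\<in>insert m K. Poly_Mapping.single m (Poly_Mapping.lookup F m)) =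
        cubic n (\<lambda>i j k. d i j k + c i j k)"
      using insert.hyps by (simp add: cubic_add)
    then show ?case by blast
  qed
  from this[of "Poly_Mapping.keys F"] show ?thesis by (simp add: sum_of_monomials)
qed

text \<open>
  Averaging an array over the six permutations of its indices does not change the cubic, so
  characteristic zero yields a symmetric array.
\<close>
lemma form_3_eq_symmetric_cubic:
  fixes F :: "'k::field_char_0 mpoly"
  assumes "F \<in> forms n 3"
  obtains c where "F = cubic n c" "\<And>i j k. c i j k = c j i k" "\<And>i j k. c i j k = c i k j"
proof -
  obtain d where F: "F = cubic n d" using form_3_eq_cubic[OF assms] by blast
  define e where "e i j k = d i j k + d j i k + d i k j + d j k i + d k i j + d k j i" for i j k
  define c where "c i j k = 1 / 6 * e i j k" for i j k
  have p: "cubic n (\<lambda>i j k. d j k i) = cubic n d" "cubic n (\<lambda>i j k. d k i j) = cubic n d"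
      "cubic n (\<lambda>i j k. d k j i) = cubic n d"
  proof -
    show "cubic n (\<lambda>i j k. d j k i) = cubic n d"
      using cubic_permute(1)[of n "\<lambda>i j k. d i k j"] cubic_permute(2)[of n d] by (rule trans)
    show *: "cubic n (\<lambda>i j k. d k i j) = cubic n d"
      using cubic_permute(2)[of n "\<lambda>i j k. d j i k"] cubic_permute(1)[of n d] by (rule trans)
    show "cubic n (\<lambda>i j k. d k j i) = cubic n d"
      using cubic_permute(1)[of n "\<lambda>i j k. d k i j"] * by (rule trans)
  qed
  have "cubic n e = F + F + F + F + F + F"
    unfolding e_def cubic_add p cubic_permute[of n d] F ..
  also have "\<dots> = (1 + 1 + 1 + 1 + 1 + 1) * F"
    by (simp only: distrib_right mult_1_left)
  finally have "cubic n e = 6 * F" by simp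
  then have "Const (1 / 6) * cubic n e = Const (1 / 6) * (Const 6 * F)"
    by (simp add: Const_def)
  moreover have "Const (1 / 6) * cubic n e = cubic n c"
    by (simp only: cubic_def c_def Const_mult sum_distrib_left mult.assoc)
  moreover have "Const (1 / 6) * (Const 6 * F) = F"
    by (simp add: Const_one flip: Const_mult mult.assoc)
  ultimately have "F = cubic n c" by simp
  then show ?thesis
    by (rule that) (simp_all add: c_def e_def add_ac)
qed

lemma eval_cubic:
  "eval a (cubic n c) = (\<Sum>i<n. \<Sum>j<n. \<Sum>k<n. c i j k * (a i * a j * a k))"
  by (simp add: cubic_def eval_simps)

lemma subst_cubic:
  "subst g (cubic n c) = (\<Sum>i<n. \<Sum>j<n. \<Sum>k<n. Const (c i j k) * (g i * g j * g k))"
  by (simp add: cubic_def subst_simps)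

section \<open>Linear algebra in dimension three\<close>

text \<open>
  Gaussian elimination on the last equation. The unknowns are indexed by an arbitrary finite set so
  that the pivot can be removed without renumbering.
\<close>
lemma underdetermined_system:
  fixes M :: "nat \<Rightarrow> 'i \<Rightarrow> 'k::field"
  assumes "finite J" "m < card J"
  shows "\<exists>x. (\<exists>j\<in>J. x j \<noteq> 0) \<and> (\<forall>r<m. (\<Sum>j\<in>J. M r j * x j) = 0)"
  using assms
proof (induction m arbitrary: J M)
  case 0
  then have "J \<noteq> {}" by auto
  then show ?case by (intro exI[of _ "\<lambda>_. 1"]) auto
next
  case (Suc m)
  show ?case
  proof (cases "\<forall>j\<in>J. M m j = 0")
    case True
    obtain x where x: "\<exists>j\<in>J. x j \<noteq> 0" "\<forall>r<m. (\<Sum>j\<in>J. M r j * x j) = 0"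
      using Suc.IH[of J M] Suc.prems by auto
    have "(\<Sum>j\<in>J. M m j * x j) = 0"
      using True by (intro sum.neutral) auto
    with x show ?thesis by (auto simp: less_Suc_eq)
  next
    case False
    then obtain q where q: "q \<in> J" "M m q \<noteq> 0" by blast
    define K where "K = J - {q}"
    have J: "J = insert q K" "q \<notin> K" "finite K" "m < card K"
      using q Suc.prems by (auto simp: K_def)
    define M' where "M' r j = M r j - M r q * (M m j / M m q)" for r j
    obtain x where x: "\<exists>j\<in>K. x j \<noteq> 0" "\<forall>r<m. (\<Sum>j\<in>K. M' r j * x j) = 0"
      using Suc.IH[OF J(3,4), of M'] by blast
    define s where "s = (\<Sum>j\<in>K. M m j * x j)"
    define y where "y = x(q := - s / M m q)"
    have sum_y: "(\<Sum>j\<in>J. M r j * y j) = (\<Sum>j\<in>K. M r j * x j) - M r q * (s / M m q)" for r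
    proof -
      have "(\<Sum>j\<in>K. M r j * y j) = (\<Sum>j\<in>K. M r j * x j)"
        using J(2) by (intro sum.cong) (auto simp: y_def)
      then show ?thesis using J by (simp add: y_def)
    qed
    have "(\<Sum>j\<in>J. M r j * y j) = 0" if "r < Suc m" for r
    proof (cases "r = m")
      case True
      then show ?thesis unfolding sum_y using q by (simp add: s_def)
    next
      case False
      then have "(\<Sum>j\<in>K. M' r j * x j) = 0" using that x by auto
      then show ?thesis unfolding sum_y
        by (simp add: M'_def s_def left_diff_distrib right_diff_distrib sum_subtractf sum_distrib_left sum_divide_distrib mult_ac)
    qed
    moreover have "\<exists>j\<in>J. y j \<noteq> 0" using x(1) J by (auto simp: y_def)
    ultimately show ?thesis by blast
  qed
qed

lemma sum_3: "(\<Sum>i<3. f i) = f (0::nat) + f 1 + (f 2 :: 'a::comm_monoid_add)"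
  by (simp add: eval_nat_numeral add_ac)

lemma all_less_3: "(\<forall>i<3. P i) \<longleftrightarrow> P 0 \<and> P 1 \<and> P (2::nat)"
  by (auto simp: eval_nat_numeral less_Suc_eq)

definition det3 :: "(nat \<Rightarrow> nat \<Rightarrow> 'k) \<Rightarrow> 'k::comm_ring_1" where
  "det3 M = M 0 0 * (M 1 1 * M 2 2 - M 1 2 * M 2 1) - M 0 1 * (M 1 0 * M 2 2 - M 1 2 * M 2 0)
    + M 0 2 * (M 1 0 * M 2 1 - M 1 1 * M 2 0)"

lemma det3_mult: "det3 (\<lambda>i j. \<Sum>k<3. A i k * B k j) = det3 A * det3 B"
  unfolding det3_def sum_3 by (simp add: algebra_simps)

lemma cramer3:
  fixes M :: "nat \<Rightarrow> nat \<Rightarrow> 'k::field"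
  assumes "det3 M \<noteq> 0"
  shows "\<exists>x. \<forall>i<3. (\<Sum>j<3. M i j * x j) = b i"
proof -
  define x where "x j = det3 (\<lambda>i j'. if j' = j then b i else M i j') / det3 M" for j
  have "(\<Sum>j<3. M i j * x j) = b i" if "i < 3" for i
  proof -
    have "(\<Sum>j<3. M i j * det3 (\<lambda>i j'. if j' = j then b i else M i j')) = det3 M * b i"
    proof -
      consider "i = 0" | "i = 1" | "i = 2" using \<open>i < 3\<close> by linarith
      then show ?thesis
        by cases (simp_all add: sum_3 det3_def algebra_simps)
    qed
    then show ?thesis
      using assms by (simp add: x_def sum_divide_distrib[symmetric] field_simps)
  qed
  then show ?thesis by blast
qed

section \<open>The trilinear form of a cubic\<close>

definition unit_vec :: "nat \<Rightarrow> nat \<Rightarrow> 'k::zero_neq_one" where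
  "unit_vec i j = (if j = i then 1 else 0)"

text \<open>
  The symmetric trilinear form \<open>T\<close> with coefficients \<open>c\<close> is the
  polarisation of the cubic form: \<open>T a a a\<close> is its value at \<open>a\<close>.
\<close>
locale symmetric_array =
  fixes n :: nat and c :: "nat \<Rightarrow> nat \<Rightarrow> nat \<Rightarrow> 'k::field_char_0"
  assumes sym12: "c i j k = c j i k" and sym23: "c i j k = c i k j"
begin

definition T :: "(nat \<Rightarrow> 'k) \<Rightarrow> (nat \<Rightarrow> 'k) \<Rightarrow> (nat \<Rightarrow> 'k) \<Rightarrow> 'k" where
  "T u v w = (\<Sum>i<n. \<Sum>j<n. \<Sum>k<n. c i j k * (u i * v j * w k))"

lemma T_cong:
  assumes "\<And>i. i < n \<Longrightarrow> u i = u' i" "\<And>i. i < n \<Longrightarrow> v i = v' i" "\<And>i. i < n \<Longrightarrow> w i = w' i"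
  shows "T u v w = T u' v' w'"
  using assms by (simp add: T_def)

lemma T_swap12: "T u v w = T v u w"
  unfolding T_def by (subst sum.swap) (simp add: mult_ac sym12)

lemma T_swap23: "T u v w = T u w v"
  unfolding T_def
  by (rule sum.cong[OF refl], subst sum.swap) (simp add: mult_ac sym23)

lemma T_add1: "T (\<lambda>i. u i + u' i) v w = T u v w + T u' v w"
  by (simp add: T_def algebra_simps sum.distrib)

lemma T_scale1: "T (\<lambda>i. x * u i) v w = x * T u v w"
  by (simp add: T_def sum_distrib_left mult_ac)

lemma T_add2: "T u (\<lambda>i. v i + v' i) w = T u v w + T u v' w"
  by (simp add: T_def algebra_simps sum.distrib)

lemma T_scale2: "T u (\<lambda>i. x * v i) w = x * T u v w"
  by (simp add: T_def sum_distrib_left mult_ac)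

lemma T_add3: "T u v (\<lambda>i. w i + w' i) = T u v w + T u v w'"
  by (simp add: T_def algebra_simps sum.distrib)

lemma T_scale3: "T u v (\<lambda>i. x * w i) = x * T u v w"
  by (simp add: T_def sum_distrib_left mult_ac)

lemmas T_linear = T_add1 T_add2 T_add3 T_scale1 T_scale2 T_scale3

lemma T_unit: "i < n \<Longrightarrow> j < n \<Longrightarrow> k < n \<Longrightarrow> T (unit_vec i) (unit_vec j) (unit_vec k) = c i j k"
proof -
  assume *: "i < n" "j < n" "k < n"
  have "c i' j' k' * (unit_vec i i' * unit_vec j j' * unit_vec k k') =
    (if k' = k then if j' = j then if i' = i then c i j k else 0 else 0 else 0)" for i' j' k'
    by (auto simp: unit_vec_def)
  then show ?thesis using * by (simp add: T_def)
qed

lemma T_expand1: "(\<Sum>i<n. u i * T (unit_vec i) v w) = T u v w"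
proof -
  have "T (unit_vec i) v w = (\<Sum>j<n. \<Sum>k<n. c i j k * (v j * w k))" if "i < n" for i
  proof -
    have "(\<Sum>j<n. \<Sum>k<n. c i' j k * (unit_vec i i' * v j * w k)) =
      (if i' = i then \<Sum>j<n. \<Sum>k<n. c i j k * (v j * w k) else 0)" for i'
      by (simp add: unit_vec_def)
    then show ?thesis using that by (simp add: T_def)
  qed
  then show ?thesis by (simp add: T_def sum_distrib_left mult_ac)
qed

lemma T_expand3: "(\<Sum>i<n. w i * T u v (unit_vec i)) = T u v w"
  using T_expand1[of w u v] by (simp add: T_swap12[of _ u] T_swap23[of u])

lemma T_polarise:
  "6 * T u v w = T (\<lambda>i. u i + v i + w i) (\<lambda>i. u i + v i + w i) (\<lambda>i. u i + v i + w i)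
    - T (\<lambda>i. u i + v i) (\<lambda>i. u i + v i) (\<lambda>i. u i + v i)
    - T (\<lambda>i. u i + w i) (\<lambda>i. u i + w i) (\<lambda>i. u i + w i)
    - T (\<lambda>i. v i + w i) (\<lambda>i. v i + w i) (\<lambda>i. v i + w i) + T u u u + T v v v + T w w w"
proof -
  have "T u w v = T u v w" "T v u w = T u v w" "T v w u = T u v w" "T w u v = T u v w" "T w v u = T u v w"
    by (metis T_swap12 T_swap23)+
  then show ?thesis by (simp add: T_linear)
qed

lemma T_polarise2:
  "2 * T z u v = T z (\<lambda>i. u i + v i) (\<lambda>i. u i + v i) - T z u u - T z v v"
  by (simp add: T_linear T_swap23[of z v u])

end

text \<open>
  By polarisation, the values of a cubic form determine its symmetric array. Together with
  \<open>linear_form_cubed\<close> this turns the polynomial identity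
  \<open>F = l\<^sub>1\<^sup>3 + \<dots> + l\<^sub>m\<^sup>3\<close> into identities between
  elements of the field, in both directions.
\<close>
lemma symmetric_array_eqI:
  assumes "symmetric_array c" "symmetric_array d"
    and eq: "\<And>a. symmetric_array.T n c a a a = symmetric_array.T n d a a a"
    and "i < n" "j < n" "k < n"
  shows "c i j k = d i j k"
proof -
  interpret c: symmetric_array n c by fact
  interpret d: symmetric_array n d by fact
  have "6 * c.T u v w = 6 * d.T u v w" for u v w
    unfolding c.T_polarise d.T_polarise by (simp only: eq)
  then have "c.T u v w = d.T u v w" for u v w by simp
  then show ?thesis
    using c.T_unit[OF assms(4-6)] d.T_unit[OF assms(4-6)] by simp
qed

section \<open>General position\<close>

text \<open>
  A condition on a pair of vectors \<open>v, w\<close> is generic if it says that a polynomial in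
  the coordinates of \<open>v\<close> and \<open>w\<close> does not vanish. All that is needed of
  such polynomial functions is that they restrict to univariate polynomials on lines, so they are
  described by closure rules and not by terms.
\<close>
inductive polyfun2 :: "((nat \<Rightarrow> 'k) \<Rightarrow> (nat \<Rightarrow> 'k) \<Rightarrow> 'k::field) \<Rightarrow> bool" where
  const: "polyfun2 (\<lambda>v w. a)"
| left: "polyfun2 (\<lambda>v w. v i)"
| right: "polyfun2 (\<lambda>v w. w i)"
| add: "polyfun2 f \<Longrightarrow> polyfun2 g \<Longrightarrow> polyfun2 (\<lambda>v w. f v w + g v w)"
| mult: "polyfun2 f \<Longrightarrow> polyfun2 g \<Longrightarrow> polyfun2 (\<lambda>v w. f v w * g v w)"

lemma polyfun2_diff:
  assumes "polyfun2 f" "polyfun2 g"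
  shows "polyfun2 (\<lambda>v w. f v w - g v w)"
  using polyfun2.add[OF assms(1) polyfun2.mult[OF polyfun2.const[of "- 1"] assms(2)]] by simp

lemma polyfun2_uminus: "polyfun2 f \<Longrightarrow> polyfun2 (\<lambda>v w. - f v w)"
  using polyfun2_diff[OF polyfun2.const[of 0]] by simp

lemma polyfun2_power: "polyfun2 f \<Longrightarrow> polyfun2 (\<lambda>v w. f v w ^ n)"
  by (induction n) (auto intro: polyfun2.intros)

lemma polyfun2_sum: "(\<And>i. polyfun2 (f i)) \<Longrightarrow> polyfun2 (\<lambda>v w. \<Sum>i\<in>I. f i v w)"
  by (induction I rule: infinite_finite_induct) (auto intro: polyfun2.intros)

lemma polyfun2_prod: "(\<And>i. polyfun2 (f i)) \<Longrightarrow> polyfun2 (\<lambda>v w. \<Prod>i\<in>I. f i v w)"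
  by (induction I rule: infinite_finite_induct) (auto intro: polyfun2.intros)

lemma polyfun2_eval:
  "(\<And>i. polyfun2 (\<lambda>v w. a v w i)) \<Longrightarrow> polyfun2 (\<lambda>v w. eval (a v w) p)"
  unfolding eval_def
  by (intro polyfun2_sum polyfun2.mult polyfun2.const polyfun2_prod polyfun2_power)

lemma polyfun2_swap: "polyfun2 f \<Longrightarrow> polyfun2 (\<lambda>v w. f w v)"
  by (induction rule: polyfun2.induct) (auto intro: polyfun2.intros)

lemma polyfun2_line:
  "polyfun2 f \<Longrightarrow> \<exists>p. \<forall>t. f (\<lambda>i. v i + t * v' i) (\<lambda>i. w i + t * w' i) = poly p t"
proof (induction rule: polyfun2.induct)
  case (const a)
  show ?case by (rule exI[of _ "[:a:]"]) simp
next
  case (left i)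
  show ?case by (rule exI[of _ "[:v i, v' i:]"]) simp
next
  case (right i)
  show ?case by (rule exI[of _ "[:w i, w' i:]"]) simp
next
  case (add f g)
  then show ?case by (metis poly_add)
next
  case (mult f g)
  then show ?case by (metis poly_mult)
qed

text \<open>
  For two functions, join a nonzero of the first to a nonzero of the second by a line. On it both
  become nonzero univariate polynomials, whose product has only finitely many roots.
\<close>
lemma polyfun2_common_nonzero:
  fixes fs :: "((nat \<Rightarrow> 'k) \<Rightarrow> (nat \<Rightarrow> 'k) \<Rightarrow> 'k::field_char_0) list"
  assumes "\<forall>f\<in>set fs. polyfun2 f \<and> (\<exists>v w. f v w \<noteq> 0)"
  shows "\<exists>v w. \<forall>f\<in>set fs. f v w \<noteq> 0"
proof -
  define F where "F = foldr (\<lambda>f g v w. f v w * g v w) fs (\<lambda>v w. 1)"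
  have "polyfun2 F \<and> (\<exists>v w. F v w \<noteq> 0)"
    unfolding F_def using assms
  proof (induction fs)
    case Nil
    then show ?case by (auto intro: polyfun2.intros)
  next
    case (Cons f fs)
    define g where "g = foldr (\<lambda>f g v w. f v w * g v w) fs (\<lambda>v w. 1)"
    have g: "polyfun2 g" "\<exists>v w. g v w \<noteq> 0" using Cons by (auto simp: g_def)
    have f: "polyfun2 f" "\<exists>v w. f v w \<noteq> 0" using Cons by auto
    obtain v w v' w' where nz: "f v w \<noteq> 0" "g v' w' \<noteq> 0" using f g by blast
    let ?v = "\<lambda>t i. v i + t * (v' i - v i)" and ?w = "\<lambda>t i. w i + t * (w' i - w i)"
    obtain p q where p: "\<And>t. f (?v t) (?w t) = poly p t" and q: "\<And>t. g (?v t) (?w t) = poly q t"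
      using polyfun2_line[OF f(1)] polyfun2_line[OF g(1)] by meson
    have "poly p 0 \<noteq> 0" "poly q 1 \<noteq> 0" using nz p[of 0] q[of 1] by auto
    then have "p * q \<noteq> 0" by auto
    then have "finite {t. poly (p * q) t = 0}" by (rule poly_roots_finite)
    then obtain t where "poly (p * q) t \<noteq> 0"
      using ex_new_if_finite[OF infinite_UNIV_char_0] by blast
    then have "f (?v t) (?w t) * g (?v t) (?w t) \<noteq> 0" using p q by simp
    moreover have "polyfun2 (\<lambda>v w. f v w * g v w)" using f g by (intro polyfun2.mult)
    ultimately show ?case by (simp add: g_def[symmetric]) blast
  qed
  then obtain v w where "F v w \<noteq> 0" by blast
  then have "\<forall>f\<in>set fs. f v w \<noteq> 0" unfolding F_def by (induction fs) auto
  then show ?thesis by blast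
qed

section \<open>Cubics with vanishing Hessian\<close>

context symmetric_array begin

lemma polyfun2_T:
  assumes "\<And>i. polyfun2 (\<lambda>v w. x v w i)" "\<And>i. polyfun2 (\<lambda>v w. y v w i)" "\<And>i. polyfun2 (\<lambda>v w. z v w i)"
  shows "polyfun2 (\<lambda>v w. T (x v w) (y v w) (z v w))"
  unfolding T_def by (intro polyfun2_sum polyfun2.mult polyfun2.const assms)

lemma T_zero: "T (\<lambda>i. 0) v w = 0" "T v (\<lambda>i. 0) w = 0" "T v w (\<lambda>i. 0) = 0"
  by (simp_all add: T_def)

lemmas T_sym = T_swap12 T_swap23

text \<open>
  If the whole space is spanned by \<open>v\<close>, \<open>y\<close> and \<open>K\<close>, then the
  vanishing of the listed values on the diagonal of \<open>K\<close> already forces, by polarisation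
  inside \<open>K\<close>, that every vector of \<open>K\<close> is a kernel vector of the trilinear
  form.
\<close>
lemma T_kernel_criterion:
  assumes add: "\<And>z z'. z \<in> K \<Longrightarrow> z' \<in> K \<Longrightarrow> (\<lambda>i. z i + z' i) \<in> K"
    and decomp: "\<And>u. \<exists>\<alpha> \<beta>. \<exists>\<kappa>\<in>K. u = (\<lambda>i. \<alpha> * v i + \<beta> * y i + \<kappa> i)"
    and zero: "\<And>z. z \<in> K \<Longrightarrow> T z v v = 0 \<and> T z v y = 0 \<and> T z y y = 0 \<and> T v z z = 0 \<and> T y z z = 0 \<and> T z z z = 0"
    and z: "z \<in> K"
  shows "T z u w = 0"
proof -
  have pol: "T v z z' = 0" "T y z z' = 0" if "z' \<in> K" for z'
    using T_polarise2[of v z z'] T_polarise2[of y z z'] zero add z that by simp_all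
  have pol3: "T z z' z'' = 0" if "z' \<in> K" "z'' \<in> K" for z' z''
    using T_polarise[of z z' z''] zero[OF add[OF z that(1)]] zero[OF add[OF z that(2)]]
      zero[OF add[OF that]] zero[OF add[OF add[OF z that(1)] that(2)]] zero z that
    by simp
  obtain \<alpha> \<beta> \<kappa> where u: "\<kappa> \<in> K" "u = (\<lambda>i. \<alpha> * v i + \<beta> * y i + \<kappa> i)"
    using decomp by blast
  obtain \<alpha>' \<beta>' \<kappa>' where w: "\<kappa>' \<in> K" "w = (\<lambda>i. \<alpha>' * v i + \<beta>' * y i + \<kappa>' i)"
    using decomp by blast
  have "T z y v = 0" "T z v \<kappa>' = 0" "T z y \<kappa>' = 0" "T z \<kappa> v = 0" "T z \<kappa> y = 0"
    using zero[OF z] pol[OF u(1)] pol[OF w(1)] by (metis T_sym)+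
  then show ?thesis
    unfolding u(2) w(2) using zero[OF z] pol3[OF u(1) w(1)] by (simp add: T_linear)
qed

end

locale ternary_cubic = symmetric_array 3 c for c :: "nat \<Rightarrow> nat \<Rightarrow> nat \<Rightarrow> 'k::field_char_0"
begin

text \<open>
  The determinant of the quadratic form \<open>T v\<close>, that is the Hessian of the cubic up to a
  constant factor.
\<close>
definition hessian :: "(nat \<Rightarrow> 'k) \<Rightarrow> 'k" where
  "hessian v = det3 (\<lambda>i j. T v (unit_vec i) (unit_vec j))"

text \<open>
  The Gram matrix of three vectors is congruent to the Hessian matrix.
\<close>
lemma gram_det: "det3 (\<lambda>i j. T v (b i) (b j)) = det3 b ^ 2 * hessian v"
proof -
  have "T v (b i) (b j) =
      (\<Sum>k<3. b i k * (\<Sum>l<3. T v (unit_vec k) (unit_vec l) * b j l))" for i j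
  proof -
    have "T v (b i) (b j) = T (b i) v (b j)" by (rule T_swap12)
    also have "\<dots> = (\<Sum>k<3. b i k * T (unit_vec k) v (b j))" by (rule T_expand1[symmetric])
    also have "\<dots> = (\<Sum>k<3. b i k * T v (unit_vec k) (b j))" by (simp add: T_swap12[of v])
    also have "\<dots> = (\<Sum>k<3. b i k * (\<Sum>l<3. T v (unit_vec k) (unit_vec l) * b j l))"
      by (simp add: T_expand3[of "b j", symmetric] mult.commute)
    finally show ?thesis .
  qed
  then have "det3 (\<lambda>i j. T v (b i) (b j)) = det3 b * (hessian v * det3 (\<lambda>l j. b j l))"
    by (simp only: det3_mult hessian_def)
  also have "det3 (\<lambda>l j. b j l) = det3 b"
    by (simp add: det3_def algebra_simps)
  finally show ?thesis by (simp add: power2_eq_square)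
qed

lemma gram_det_zero:
  assumes "hessian v = 0"
  shows "T v x x * (T v y y * T v z z - T v y z ^ 2) - T v x y * (T v x y * T v z z - T v y z * T v x z)
    + T v x z * (T v x y * T v y z - T v y y * T v x z) = 0"
proof -
  define b where "b = (\<lambda>i::nat. if i = 0 then x else if i = 1 then y else z)"
  have b: "b 0 = x" "b 1 = y" "b (Suc 0) = y" "b 2 = z" by (simp_all add: b_def)
  show ?thesis
    using gram_det[of v b] assms
    by (simp add: det3_def b power2_eq_square T_swap23[of v y x] T_swap23[of v z x] T_swap23[of v z y])
qed

lemma common_zero:
  "\<exists>z. (\<exists>i<3. z i \<noteq> 0) \<and> T a b z = 0 \<and> T a' b' z = 0"
proof -
  define M where "M r j = (if r = 0 then T a b (unit_vec j) else T a' b' (unit_vec j))" for r j :: nat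
  have "\<exists>z. (\<exists>i\<in>{..<3}. z i \<noteq> 0) \<and> (\<forall>r<2. (\<Sum>j<3. M r j * z j) = 0)"
    by (rule underdetermined_system) auto
  then obtain z where z: "\<exists>i<3. z i \<noteq> 0" and M: "\<And>r. r < 2 \<Longrightarrow> (\<Sum>j<3. z j * M r j) = 0"
    by (auto simp: mult.commute)
  have "T a b z = 0" "T a' b' z = 0"
    using M[of 0] M[of 1] by (simp_all add: M_def T_expand3)
  with z show ?thesis by blast
qed

text \<open>
  Hesse's theorem for three variables: a ternary cubic whose Hessian vanishes identically is a cone.
  By \<open>gram_det_zero\<close> all Gram determinants vanish, so it suffices to choose good
  vectors. Start with \<open>v\<close> not on the curve and let \<open>M\<close> be the plane of all
  \<open>y\<close> with \<open>T v v y = 0\<close>. The quadratic form \<open>T v\<close> is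
  singular, hence has rank one or zero on \<open>M\<close>. If it does not vanish at some
  \<open>y \<in> M\<close>, the kernel vector of the cubic is found in the kernel of
  \<open>T v\<close>. If it vanishes on \<open>M\<close>, the cubic splits as the cube of a linear
  form plus a binary cubic on \<open>M\<close>; the Hessian of the latter vanishes too, so it is the
  cube of a linear form or zero.
\<close>
lemma hessian_zero_imp_kernel:
  assumes H: "\<And>v. hessian v = 0"
  shows "\<exists>z. (\<exists>i<3. z i \<noteq> 0) \<and> (\<forall>u w. T z u w = 0)"
proof (cases "\<forall>v. T v v v = 0")
  case True
  then have "6 * T u v w = 0" for u v w by (simp add: T_polarise)
  then show ?thesis by (intro exI[of _ "\<lambda>_. 1"]) (auto intro!: exI[of _ "0::nat"])
next
  case False
  then obtain v where A: "T v v v \<noteq> 0" by blast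
  note gram = gram_det_zero[OF H]
  show ?thesis
  proof (cases "\<exists>y. T v v y = 0 \<and> T v y y \<noteq> 0")
    case True
    then obtain y where y: "T v v y = 0" "T v y y \<noteq> 0" by blast
    define K where "K = {z. T v v z = 0 \<and> T v y z = 0}"
    have zero: "T z v v = 0 \<and> T z v y = 0 \<and> T z y y = 0 \<and> T v z z = 0 \<and> T y z z = 0 \<and> T z z z = 0"
      if "z \<in> K" for z
    proof -
      have z: "T v v z = 0" "T v y z = 0" using that by (auto simp: K_def)
      have sym: "T z v v = T v v z" "T z v y = T v y z" "T z y y = T y y z" "T z y z = T y z z"
         "T z v z = T v z z" "T y v v = T v v y" "T y v y = T v y y" "T y v z = T v y z"
         "T v z y = T v y z" "T y z y = T y y z" "T z z y = T y z z" "T v y v = T v v y" "T z z v = T v z z"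
        by (metis T_sym)+
      \<comment> \<open>The Gram determinants are taken in the basis \<open>v, y, z\<close>, for the quadratic forms of the points
        \<open>v\<close>, \<open>z + v\<close>, \<open>z - v\<close> and \<open>v + y\<close> in turn.\<close>
      have vzz: "T v z z = 0"
        using gram[of v v y z] A y z by simp
      have "T v v v * ((T v y y + T y y z) * T z z z - T y z z ^ 2) = 0"
        using gram[of "\<lambda>i. v i + z i" v y z] y z vzz by (simp add: T_linear sym)
      moreover have "- T v v v * ((- T v y y + T y y z) * T z z z - T y z z ^ 2) = 0"
        using gram[of "\<lambda>i. (- 1) * v i + z i" v y z] y z vzz
        unfolding T_linear sym by simp
      ultimately have "(T v y y + T y y z) * T z z z - T y z z ^ 2 = 0"
          "(- T v y y + T y y z) * T z z z - T y z z ^ 2 = 0" using A by auto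
      then have "2 * (T v y y * T z z z) = 0" and yzz: "(T v y y + T y y z) * T z z z - T y z z ^ 2 = 0"
        by algebra+
      then have zzz: "T z z z = 0" using y by simp
      with yzz have yzz: "T y z z = 0" by simp
      have "T v v v * T y y z ^ 2 = 0"
        using gram[of "\<lambda>i. v i + y i" v y z] y z vzz yzz by (simp add: T_linear sym)
      then have "T y y z = 0" using A by simp
      with z vzz yzz zzz show ?thesis by (simp add: sym)
    qed
    have decomp: "\<exists>\<alpha> \<beta>. \<exists>\<kappa>\<in>K. u = (\<lambda>i. \<alpha> * v i + \<beta> * y i + \<kappa> i)" for u
    proof (intro exI bexI)
      let ?\<alpha> = "T v v u / T v v v" and ?\<beta> = "T v y u / T v y y"
      let ?\<kappa> = "\<lambda>i. u i + ((- ?\<alpha>) * v i + (- ?\<beta>) * y i)"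
      show "u = (\<lambda>i. ?\<alpha> * v i + ?\<beta> * y i + ?\<kappa> i)" by (rule ext) simp
      have "T v y v = 0" using y by (metis T_sym)
      then show "?\<kappa> \<in> K" unfolding K_def mem_Collect_eq T_linear using A y by simp
    qed
    obtain z where "\<exists>i<3. z i \<noteq> 0" "z \<in> K"
      using common_zero[of v v v y] by (auto simp: K_def)
    moreover have "T z u w = 0" for u w
      by (rule T_kernel_criterion[OF _ decomp zero \<open>z \<in> K\<close>]) (auto simp: K_def T_linear)
    ultimately show ?thesis by blast
  next
    case False
    then have iso: "T v y y = 0" if "T v v y = 0" for y using that by blast
    have iso2: "T v y z = 0" if "T v v y = 0" "T v v z = 0" for y z
      using T_polarise2[of v y z] iso[OF that(1)] iso[OF that(2)] iso[of "\<lambda>i. y i + z i"] that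
      by (simp add: T_linear)
    show ?thesis
    proof (cases "\<exists>y. T v v y = 0 \<and> T y y y \<noteq> 0")
      case True
      then obtain y where y: "T v v y = 0" "T y y y \<noteq> 0" by blast
      note vyy = iso[OF y(1)]
      define K where "K = {z. T v v z = 0 \<and> T y y z = 0}"
      have zero: "T z v v = 0 \<and> T z v y = 0 \<and> T z y y = 0 \<and> T v z z = 0 \<and> T y z z = 0 \<and> T z z z = 0"
        if "z \<in> K" for z
      proof -
        have z: "T v v z = 0" "T y y z = 0" using that by (auto simp: K_def)
        have sym: "T z v v = T v v z" "T z v y = T v y z" "T z y y = T y y z" "T z y z = T y z z"
         "T z v z = T v z z" "T y v v = T v v y" "T y v y = T v y y" "T y v z = T v y z"
         "T v z y = T v y z" "T y z y = T y y z" "T z z y = T y z z" "T v y v = T v v y" "T z z v = T v z z"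
          by (metis T_sym)+
        have vz: "T v y z = 0" "T v z z = 0" using iso2 y z by blast+
        have "T v v v * T y y y * T y z z = 0"
          using gram[of "\<lambda>i. v i + y i" v y z] y z vyy vz by (simp add: T_linear sym)
        then have yzz: "T y z z = 0" using A y by simp
        have "T v v v * T y y y * T z z z = 0"
          using gram[of "\<lambda>i. v i + y i + z i" v y z] y z vyy vz yzz by (simp add: T_linear sym)
        then have "T z z z = 0" using A y by simp
        with z vz yzz show ?thesis by (simp add: sym)
      qed
      have decomp: "\<exists>\<alpha> \<beta>. \<exists>\<kappa>\<in>K. u = (\<lambda>i. \<alpha> * v i + \<beta> * y i + \<kappa> i)" for u
      proof (intro exI bexI)
        let ?\<alpha> = "T v v u / T v v v" and ?\<beta> = "T y y u / T y y y"
        let ?\<kappa> = "\<lambda>i. u i + ((- ?\<alpha>) * v i + (- ?\<beta>) * y i)"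
        show "u = (\<lambda>i. ?\<alpha> * v i + ?\<beta> * y i + ?\<kappa> i)" by (rule ext) simp
        have "T y y v = 0" using vyy by (metis T_sym)
        then show "?\<kappa> \<in> K" unfolding K_def mem_Collect_eq T_linear using A y by simp
      qed
      obtain z where "\<exists>i<3. z i \<noteq> 0" "z \<in> K"
        using common_zero[of v v y y] by (auto simp: K_def)
      moreover have "T z u w = 0" for u w
        by (rule T_kernel_criterion[OF _ decomp zero \<open>z \<in> K\<close>]) (auto simp: K_def T_linear)
      ultimately show ?thesis by blast
    next
      case False
      define K where "K = {z. T v v z = 0}"
      define y :: "nat \<Rightarrow> 'k" where "y = (\<lambda>i. 0)"
      have zero: "T z v v = 0 \<and> T z v y = 0 \<and> T z y y = 0 \<and> T v z z = 0 \<and> T y z z = 0 \<and> T z z z = 0"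
        if "z \<in> K" for z
        using that False iso[of z] T_swap12[of z v v] T_swap23[of v z v]
        by (auto simp: K_def y_def T_zero)
      have decomp: "\<exists>\<alpha> \<beta>. \<exists>\<kappa>\<in>K. u = (\<lambda>i. \<alpha> * v i + \<beta> * y i + \<kappa> i)" for u
      proof (intro exI bexI)
        let ?\<alpha> = "T v v u / T v v v"
        let ?\<kappa> = "\<lambda>i. u i + (- ?\<alpha>) * v i"
        show "u = (\<lambda>i. ?\<alpha> * v i + 0 * y i + ?\<kappa> i)" by (rule ext) simp
        show "?\<kappa> \<in> K" unfolding K_def mem_Collect_eq T_linear using A by simp
      qed
      obtain z where "\<exists>i<3. z i \<noteq> 0" "z \<in> K"
        using common_zero[of v v v v] by (auto simp: K_def)
      moreover have "T z u w = 0" for u w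
        by (rule T_kernel_criterion[OF _ decomp zero \<open>z \<in> K\<close>]) (auto simp: K_def T_linear)
      ultimately show ?thesis by blast
    qed
  qed
qed

end

section \<open>Binary cubics as sums of two cubes\<close>

lemma cube_root_exists: "\<exists>y. y ^ 3 = (x :: 'k::alg_closed_field)"
  using nth_root_exists[of 3 x] by auto

text \<open>
  The numbers \<open>b0, b1, b2, s\<close> are the coefficients of a binary cubic, divided by
  binomial coefficients, and \<open>\<chi> p q = 0\<close> is the equation of the linear forms to be
  avoided. Varying \<open>s\<close> means adding a multiple of the cube of the second variable. A
  generic binary cubic is the sum of the cubes of two linear forms, which are the factors of its
  Hessian. These factors move with \<open>s\<close>, except that a factor with coefficients
  proportional to \<open>(b0, b1)\<close> or \<open>(0, 1)\<close> may stay fixed; at these two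
  points the nonvanishing of \<open>\<chi>\<close> is assumed.
\<close>
lemma binary_cubic_two_cubes:
  fixes \<chi> :: "'k \<Rightarrow> 'k \<Rightarrow> 'k::{alg_closed_field,field_char_0}"
  assumes hom: "\<And>t p q. \<chi> (t * p) (t * q) = t ^ e * \<chi> p q"
    and pol: "\<And>r. \<chi> 1 r = poly R r"
    and b0: "b0 \<noteq> 0" and \<chi>0: "\<chi> b0 b1 \<noteq> 0" and \<chi>1: "\<chi> 0 1 \<noteq> 0"
  shows "finite {s. \<not> (\<exists>p1 q1 p2 q2. \<chi> p1 q1 \<noteq> 0 \<and> \<chi> p2 q2 \<noteq> 0 \<and> b0 = p1 ^ 3 + p2 ^ 3 \<and>
    b1 = p1 ^ 2 * q1 + p2 ^ 2 * q2 \<and> b2 = p1 * q1 ^ 2 + p2 * q2 ^ 2 \<and> s = q1 ^ 3 + q2 ^ 3)}"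
    (is "finite {s. \<not> ?good s}")
proof (cases "b0 * b2 = b1 ^ 2")
  case True
  \<comment> \<open>For all \<open>s\<close> the Hessian has the factors \<open>(b0, b1)\<close> and \<open>(0, 1)\<close>, and these are the two linear forms to use.\<close>
  have "?good s" if s: "s \<noteq> b1 ^ 3 / b0 ^ 2" for s
  proof -
    obtain x where x: "x ^ 3 = b0" using cube_root_exists by blast
    obtain y where y: "y ^ 3 = s - b1 ^ 3 / b0 ^ 2" using cube_root_exists by blast
    have nz: "x \<noteq> 0" "y \<noteq> 0" using x y b0 s by auto
    have "\<chi> x (x * b1 / b0) = (x / b0) ^ e * \<chi> b0 b1"
      using hom[of "x / b0" b0 b1] b0 by simp
    then have 1: "\<chi> x (x * b1 / b0) \<noteq> 0" using nz b0 \<chi>0 by simp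
    have 2: "\<chi> 0 y \<noteq> 0" using hom[of y 0 1] nz \<chi>1 by simp
    have "x ^ 2 * (x * b1 / b0) = x ^ 3 * b1 / b0" by (simp add: power2_eq_square power3_eq_cube)
    then have 3: "x ^ 2 * (x * b1 / b0) = b1" using x b0 by simp
    have "x * (x * b1 / b0) ^ 2 = x ^ 3 * b1 ^ 2 / b0 ^ 2"
      by (simp add: power2_eq_square power3_eq_cube)
    also have "\<dots> = b2" using x b0 True[symmetric] by (simp add: power2_eq_square)
    finally have 4: "x * (x * b1 / b0) ^ 2 = b2" .
    have "(x * b1 / b0) ^ 3 = x ^ 3 * b1 ^ 3 / b0 ^ 3"
      by (simp add: power_mult_distrib power_divide)
    also have "\<dots> = b1 ^ 3 / b0 ^ 2" using x b0 by (simp add: power2_eq_square power3_eq_cube)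
    finally have 5: "(x * b1 / b0) ^ 3 + y ^ 3 = s" using y by simp
    show ?thesis
      by (rule exI[of _ x], rule exI[of _ "x * b1 / b0"], rule exI[of _ 0], rule exI[of _ y])
        (use 1 2 3 4 5 x in simp)
  qed
  then have "{s. \<not> ?good s} \<subseteq> {b1 ^ 3 / b0 ^ 2}" by blast
  then show ?thesis by (rule finite_subset) simp
next
  case False
  \<comment> \<open>The two linear forms are sought as multiples of \<open>(1, r1)\<close> and \<open>(1, r2)\<close>.  The four coefficients then satisfy
    the linear recurrence with characteristic polynomial \<open>(r - r1) (r - r2)\<close>.  So if \<open>x = r1 + r2\<close>, then \<open>r1 * r2 = e2 x\<close>,
    and \<open>s\<close> is an affine function of \<open>x\<close>, with inverse \<open>\<epsilon>\<close>.\<close>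
  define e2 where "e2 x = (x * b1 - b2) / b0" for x
  define D where "D = b2 - b1 ^ 2 / b0"
  have D: "D \<noteq> 0" using False b0 by (simp add: D_def field_simps)
  define \<epsilon> where "\<epsilon> s = (s - b1 * b2 / b0) / D" for s
  have R0: "poly R (b1 / b0) \<noteq> 0"
    using hom[of "1 / b0" b0 b1] b0 \<chi>0 pol[of "b1 / b0"] by simp
  \<comment> \<open>The excluded values of \<open>x\<close>: those with \<open>r1 = r2\<close>, and those for which a root \<open>r\<close> of \<open>R\<close> becomes one of \<open>r1, r2\<close>.\<close>
  define Bad where "Bad = {x. poly [:4 * b2 / b0, - 4 * b1 / b0, 1:] x = 0} \<union>
    (\<lambda>r. (r ^ 2 - b2 / b0) / (r - b1 / b0)) ` {r. poly R r = 0}"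
  have "finite Bad"
    unfolding Bad_def using R0 by (intro finite_UnI finite_imageI poly_roots_finite) auto
  have "?good s" if s: "\<epsilon> s \<notin> Bad" for s
  proof -
    define x where "x = \<epsilon> s"
    define P where "P = [:e2 x, - x, 1:]"
    have "degree P > 0" by (simp add: P_def)
    then obtain r1 where "poly P r1 = 0" using alg_closed_imp_poly_has_root by blast
    then have r1: "r1 ^ 2 = x * r1 - e2 x" by (simp add: P_def power2_eq_square algebra_simps)
    define r2 where "r2 = x - r1"
    have r2: "r2 ^ 2 = x * r2 - e2 x" using r1 by (simp add: r2_def power2_eq_square algebra_simps)
    have x: "x = r1 + r2" by (simp add: r2_def)
    have e2: "e2 x = r1 * r2" using r1 by (simp add: r2_def power2_eq_square algebra_simps)
    have be: "b0 * e2 x = x * b1 - b2" using b0 by (simp add: e2_def)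
    have "r1 \<noteq> r2"
    proof
      assume "r1 = r2"
      then have "x ^ 2 - 4 * e2 x = 0" using x e2 by (simp add: power2_eq_square)
      then have "poly [:4 * b2 / b0, - 4 * b1 / b0, 1:] x = 0"
        using b0 by (simp add: e2_def field_simps power2_eq_square)
      then show False using s by (auto simp: Bad_def x_def)
    qed
    have \<chi>r: "\<chi> 1 r \<noteq> 0" if r: "r ^ 2 = x * r - e2 x" for r
    proof
      assume "\<chi> 1 r = 0"
      then have R: "poly R r = 0" using pol by simp
      then have ne: "r - b1 / b0 \<noteq> 0" using R0 by auto
      have "x * (r - b1 / b0) = r ^ 2 - b2 / b0"
        using b0 by (simp add: r e2_def field_simps)
      then have "x = (r ^ 2 - b2 / b0) / (r - b1 / b0)" using ne by (simp add: field_simps)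
      then show False using s R by (auto simp: Bad_def x_def)
    qed
    define \<alpha> where "\<alpha> = (b1 - r2 * b0) / (r1 - r2)"
    define \<beta> where "\<beta> = (r1 * b0 - b1) / (r1 - r2)"
    have \<alpha>\<beta>: "\<alpha> * (r1 - r2) = b1 - r2 * b0" "\<beta> * (r1 - r2) = r1 * b0 - b1"
      using \<open>r1 \<noteq> r2\<close> by (simp_all add: \<alpha>_def \<beta>_def)
    have "(\<alpha> + \<beta>) * (r1 - r2) = b0 * (r1 - r2)"
      unfolding distrib_right \<alpha>\<beta> by (simp add: algebra_simps)
    moreover have "(\<alpha> * r1 + \<beta> * r2) * (r1 - r2) = \<alpha> * (r1 - r2) * r1 + \<beta> * (r1 - r2) * r2"
      by (simp add: algebra_simps)
    then have "(\<alpha> * r1 + \<beta> * r2) * (r1 - r2) = b1 * (r1 - r2)"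
      unfolding \<alpha>\<beta> by (simp add: algebra_simps)
    ultimately have e: "b0 = \<alpha> + \<beta>" "b1 = \<alpha> * r1 + \<beta> * r2"
      using \<open>r1 \<noteq> r2\<close> by simp_all
    have e3: "b2 = \<alpha> * r1 ^ 2 + \<beta> * r2 ^ 2"
    proof -
      have "b2 = x * b1 - e2 x * b0" using be by (simp add: algebra_simps)
      also have "\<dots> = \<alpha> * (x * r1 - e2 x) + \<beta> * (x * r2 - e2 x)"
        by (simp add: e algebra_simps)
      finally show ?thesis using r1 r2 by simp
    qed
    have "x * D = s - b1 * b2 / b0" using D by (simp add: x_def \<epsilon>_def)
    then have "s = x * b2 - e2 x * b1"
      using b0 by (simp add: D_def e2_def field_simps power2_eq_square)
    also have "\<dots> = \<alpha> * r1 * (x * r1 - e2 x) + \<beta> * r2 * (x * r2 - e2 x)"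
      by (simp add: e e3 algebra_simps power2_eq_square)
    also have "\<dots> = \<alpha> * r1 ^ 3 + \<beta> * r2 ^ 3"
      unfolding r1[symmetric] r2[symmetric] by (simp add: power2_eq_square power3_eq_cube)
    finally have e4: "s = \<alpha> * r1 ^ 3 + \<beta> * r2 ^ 3" .
    have "\<alpha> \<noteq> 0" "\<beta> \<noteq> 0"
      using False by (auto simp: e e3 power2_eq_square)
    obtain p1 where p1: "p1 ^ 3 = \<alpha>" using cube_root_exists by blast
    obtain p2 where p2: "p2 ^ 3 = \<beta>" using cube_root_exists by blast
    have nz: "p1 \<noteq> 0" "p2 \<noteq> 0" using p1 p2 \<open>\<alpha> \<noteq> 0\<close> \<open>\<beta> \<noteq> 0\<close> by auto
    have "\<chi> p1 (p1 * r1) \<noteq> 0" "\<chi> p2 (p2 * r2) \<noteq> 0"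
      using hom[of p1 1 r1] hom[of p2 1 r2] \<chi>r[OF r1] \<chi>r[OF r2] nz by simp_all
    moreover have "b1 = p1 ^ 2 * (p1 * r1) + p2 ^ 2 * (p2 * r2)"
      unfolding e(2) p1[symmetric] p2[symmetric] by (simp add: power2_eq_square power3_eq_cube)
    moreover have "b2 = p1 * (p1 * r1) ^ 2 + p2 * (p2 * r2) ^ 2"
      unfolding e3 p1[symmetric] p2[symmetric] by (simp add: power2_eq_square power3_eq_cube)
    moreover have "s = (p1 * r1) ^ 3 + (p2 * r2) ^ 3"
      unfolding e4 p1[symmetric] p2[symmetric] by (simp add: power_mult_distrib)
    moreover have "b0 = p1 ^ 3 + p2 ^ 3" using e p1 p2 by simp
    ultimately show ?thesis by blast
  qed
  then have "{s. \<not> ?good s} \<subseteq> \<epsilon> -` Bad" by blast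
  moreover have "finite (\<epsilon> -` Bad)"
    using \<open>finite Bad\<close> D by (intro finite_vimageI) (auto simp: \<epsilon>_def inj_def)
  ultimately show ?thesis by (rule finite_subset)
qed

section \<open>Five cubes suffice for a ternary cubic\<close>

text \<open>
  The closed set to be avoided only enters through one homogeneous polynomial \<open>p\<close> that
  vanishes on it.
\<close>
locale nondegenerate_ternary_cubic = ternary_cubic c
  for c :: "nat \<Rightarrow> nat \<Rightarrow> nat \<Rightarrow> 'k::{alg_closed_field,field_char_0}" +
  fixes p :: "'k mpoly" and e :: nat
  assumes no_kernel: "(\<And>u w. T z u w = 0) \<Longrightarrow> i < 3 \<Longrightarrow> z i = 0"
    and p_form: "p \<in> forms 3 e"
    and p_nonzero: "\<exists>l. eval l p \<noteq> 0"
begin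

definition \<psi> :: "(nat \<Rightarrow> 'k) \<Rightarrow> 'k" where
  "\<psi> l = eval l p"

lemma \<psi>_cong: "(\<And>i. i < 3 \<Longrightarrow> a i = b i) \<Longrightarrow> \<psi> a = \<psi> b"
  unfolding \<psi>_def using p_form by (intro eval_cong) (auto simp: forms_def polys_def)

lemma \<psi>_scale: "\<psi> (\<lambda>i. t * a i) = t ^ e * \<psi> a"
  unfolding \<psi>_def by (rule eval_scale[OF p_form])

lemma polyfun2_\<psi>: "(\<And>i. polyfun2 (\<lambda>v w. a v w i)) \<Longrightarrow> polyfun2 (\<lambda>v w. \<psi> (a v w))"
  unfolding \<psi>_def by (rule polyfun2_eval)

lemma \<psi>_line: "\<exists>R. \<forall>r. \<psi> (\<lambda>i. a i + r * b i) = poly R r"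
proof -
  have "polyfun2 (\<lambda>v w. \<psi> v)" by (intro polyfun2_\<psi> polyfun2.left)
  from polyfun2_line[OF this] show ?thesis .
qed

definition polar :: "(nat \<Rightarrow> 'k) \<Rightarrow> (nat \<Rightarrow> 'k) \<Rightarrow> nat \<Rightarrow> 'k" where
  "polar u v i = T u v (unit_vec i)"

text \<open>
  The Hessian at \<open>v\<close> of the restriction of the cubic to the span of \<open>v\<close>
  and \<open>w\<close>, up to a constant factor.
\<close>
definition gram2 :: "(nat \<Rightarrow> 'k) \<Rightarrow> (nat \<Rightarrow> 'k) \<Rightarrow> 'k" where
  "gram2 v w = T v v v * T v w w - T v v w ^ 2"

text \<open>
  The vector in the span of \<open>v\<close> and \<open>w\<close> that is orthogonal to
  \<open>w\<close> for the quadratic form \<open>T v\<close>.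
\<close>
definition conjugate :: "(nat \<Rightarrow> 'k) \<Rightarrow> (nat \<Rightarrow> 'k) \<Rightarrow> nat \<Rightarrow> 'k" where
  "conjugate v w i = T v w w * v i + (- T v v w) * w i"

definition cross :: "(nat \<Rightarrow> 'k) \<Rightarrow> (nat \<Rightarrow> 'k) \<Rightarrow> nat \<Rightarrow> 'k" where
  "cross v w i = (if i = 0 then v 1 * w 2 - v 2 * w 1
    else if i = 1 then v 2 * w 0 - v 0 * w 2 else v 0 * w 1 - v 1 * w 0)"

lemma conjugate_eq: "conjugate v w = (\<lambda>i. T v w w * v i + (- T v v w) * w i)"
  by (rule ext) (simp add: conjugate_def)

lemma polyfuns:
  "polyfun2 (\<lambda>v w. T v v w)" "polyfun2 (\<lambda>v w. \<psi> (polar v w))" "polyfun2 gram2"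
  "polyfun2 (\<lambda>v w. \<psi> (polar v (conjugate v w)))" "polyfun2 (\<lambda>v w. \<psi> (cross v w))"
  "polyfun2 (\<lambda>v w. cross v w 0)" "polyfun2 (\<lambda>v w. T v v v)" "polyfun2 (\<lambda>v w. hessian v)"
proof -
  note intros = polyfun2.intros polyfun2_uminus polyfun2_diff polyfun2_power polyfun2_T polyfun2_\<psi>
  show "polyfun2 (\<lambda>v w. T v v w)" "polyfun2 (\<lambda>v w. T v v v)"
    by (intro intros)+
  show "polyfun2 (\<lambda>v w. \<psi> (polar v w))"
    unfolding polar_def by (intro intros)
  show "polyfun2 gram2"
    unfolding gram2_def by (intro intros)
  show "polyfun2 (\<lambda>v w. \<psi> (polar v (conjugate v w)))"
    unfolding polar_def conjugate_eq by (intro intros)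
  show cross: "polyfun2 (\<lambda>v w. cross v w 0)"
    unfolding cross_def by simp (intro intros)
  have "polyfun2 (\<lambda>v w. cross v w i)" for i
    unfolding cross_def by (cases "i = 0"; cases "i = 1"; simp; intro intros)
  then show "polyfun2 (\<lambda>v w. \<psi> (cross v w))" by (intro intros)
  show "polyfun2 (\<lambda>v w. hessian v)"
    unfolding hessian_def det3_def by (intro intros)
qed

lemma nondegenerate_point: "\<exists>v. T v v v \<noteq> 0 \<and> hessian v \<noteq> 0"
proof -
  have "\<exists>v. hessian v \<noteq> 0"
    using hessian_zero_imp_kernel no_kernel by blast
  moreover have "\<exists>v. T v v v \<noteq> 0"
  proof (rule ccontr)
    assume "\<not> ?thesis"
    then have "6 * T u v w = 0" for u v w by (simp add: T_polarise)
    then have "T (\<lambda>_. 1) u w = 0" for u w by simp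
    from no_kernel[OF this, of 0] show False by simp
  qed
  ultimately have "\<exists>v w :: nat \<Rightarrow> 'k. \<forall>f\<in>set [\<lambda>v w. T v v v, \<lambda>v w. hessian v]. f v w \<noteq> 0"
    using polyfuns by (intro polyfun2_common_nonzero) auto
  then show ?thesis by auto
qed

text \<open>
  Most of these nonvanishing statements come from a point \<open>v\<close> where the quadratic form
  \<open>T v\<close> is nondegenerate: then \<open>polar v w\<close> takes every value. For the
  conjugate vectors, the map \<open>conjugate v\<close> is, up to scalars, an involution on the
  vectors of a plane through \<open>v\<close>: conjugating twice returns a multiple of the given
  vector, and the assertion reduces to the one on \<open>polar v w\<close>.
\<close>
lemma nonzero_somewhere:
  "\<exists>v w. T v v w \<noteq> 0" "\<exists>v w. \<psi> (polar v w) \<noteq> 0" "\<exists>v w. gram2 v w \<noteq> 0"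
  "\<exists>v w. \<psi> (polar v (conjugate v w)) \<noteq> 0" "\<exists>v w. \<psi> (cross v w) \<noteq> 0" "\<exists>v w. cross v w 0 \<noteq> 0"
proof -
  obtain v where v: "T v v v \<noteq> 0" "hessian v \<noteq> 0" using nondegenerate_point by blast
  have solve: "\<exists>w. \<forall>i<3. polar v w i = l i" for l
  proof -
    obtain w where "\<forall>i<3. (\<Sum>j<3. T v (unit_vec i) (unit_vec j) * w j) = l i"
      using cramer3[of "\<lambda>i j. T v (unit_vec i) (unit_vec j)"] v by (auto simp: hessian_def)
    then have "\<forall>i<3. polar v w i = l i"
      using T_expand3[of w v] by (simp add: polar_def mult.commute T_swap23[of v w])
    then show ?thesis by blast
  qed
  show 1: "\<exists>v w. T v v w \<noteq> 0" using v by blast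
  obtain l where l: "\<psi> l \<noteq> 0" using p_nonzero by (auto simp: \<psi>_def)
  show 2: "\<exists>v w. \<psi> (polar v w) \<noteq> 0"
    using solve[of l] l \<psi>_cong by metis
  show 3: "\<exists>v w. gram2 v w \<noteq> 0"
  proof (rule ccontr)
    assume "\<not> ?thesis"
    then have g: "T v v v * T v w w = T v v w ^ 2" for w by (simp add: gram2_def)
    have pol: "T v v v * T v w u = T v v w * T v v u" for w u
    proof -
      have "T v v v * (2 * T v w u) = (T v v w + T v v u) ^ 2 - T v v w ^ 2 - T v v u ^ 2"
        unfolding T_polarise2[of v w u] right_diff_distrib g unfolding T_add3 ..
      then have "2 * (T v v v * T v w u) = 2 * (T v v w * T v v u)"
        by (simp add: power2_eq_square algebra_simps)
      then show ?thesis by simp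
    qed
    obtain z i where z: "i < 3" "z i \<noteq> 0" "T v v z = 0" using common_zero[of v v v v] by blast
    obtain w where w: "\<And>j. j < 3 \<Longrightarrow> polar v w j = unit_vec i j" using solve by blast
    have "T v w z = (\<Sum>j<3. z j * polar v w j)" by (simp add: polar_def T_expand3)
    also have "\<dots> = (\<Sum>j<3. if j = i then z i else 0)"
      using w by (intro sum.cong) (auto simp: unit_vec_def)
    also have "\<dots> = z i" using z by simp
    finally have "T v w z = z i" .
    then show False using pol[of w z] v z by simp
  qed
  show "\<exists>v w. \<psi> (polar v (conjugate v w)) \<noteq> 0"
  proof -
    have "\<exists>v u. \<forall>f\<in>set [\<lambda>v u. T v v u, \<lambda>v u. \<psi> (polar v u), gram2]. f v u \<noteq> 0"
      using polyfuns 1 2 3 by (intro polyfun2_common_nonzero) auto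
    then obtain v u where nz: "T v v u \<noteq> 0" "\<psi> (polar v u) \<noteq> 0" "gram2 v u \<noteq> 0" by auto
    let ?w = "conjugate v u"
    have "T v u v = T v v u" by (rule T_swap23)
    then have *: "T v v ?w = gram2 v u" "T v ?w ?w = T v u u * gram2 v u"
      unfolding conjugate_eq T_linear by (simp_all add: gram2_def power2_eq_square algebra_simps)
    have "conjugate v ?w = (\<lambda>i. (gram2 v u * T v v u) * u i)"
      unfolding conjugate_def[of v ?w] * by (rule ext) (simp add: conjugate_def algebra_simps)
    then have "polar v (conjugate v ?w) i = (gram2 v u * T v v u) * polar v u i" for i
      by (simp only: polar_def T_linear)
    then have "polar v (conjugate v ?w) = (\<lambda>i. (gram2 v u * T v v u) * polar v u i)"
      by (rule ext)
    then have "\<psi> (polar v (conjugate v ?w)) = (gram2 v u * T v v u) ^ e * \<psi> (polar v u)"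
      by (simp only: \<psi>_scale)
    then have "\<psi> (polar v (conjugate v ?w)) \<noteq> 0" using nz by simp
    then show ?thesis by blast
  qed
  show "\<exists>v w. \<psi> (cross v w) \<noteq> 0"
  proof -
    have "\<exists>v w. \<forall>i<3. cross v w i = l i"
    proof (cases "l 2 = 0")
      case True
      show ?thesis
        by (rule exI[of _ "\<lambda>i. if i = 2 then 1 else 0"],
            rule exI[of _ "\<lambda>i. if i = 0 then l 1 else if i = 1 then - l 0 else 0"])
          (simp only: all_less_3, simp add: cross_def True)
    next
      case False
      show ?thesis
        by (rule exI[of _ "\<lambda>i. if i = 0 then 1 else if i = 1 then 0 else - l 0 / l 2"],
            rule exI[of _ "\<lambda>i. if i = 0 then 0 else if i = 1 then l 2 else - l 1"])
          (simp only: all_less_3, simp add: cross_def False)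
    qed
    then show ?thesis using l \<psi>_cong by metis
  qed
  show "\<exists>v w. cross v w 0 \<noteq> 0"
    by (rule exI[of _ "unit_vec 1"], rule exI[of _ "unit_vec 2"]) (simp add: cross_def unit_vec_def)
qed

lemma generic_pair:
  obtains v w where "T v v w \<noteq> 0" "T v w w \<noteq> 0" "\<psi> (polar v w) \<noteq> 0" "gram2 v w \<noteq> 0" "gram2 w v \<noteq> 0"
    "\<psi> (polar v (conjugate v w)) \<noteq> 0" "\<psi> (polar w (conjugate w v)) \<noteq> 0" "\<psi> (cross v w) \<noteq> 0" "cross v w 0 \<noteq> 0"
proof -
  let ?fs = "[\<lambda>v w. T v v w, \<lambda>v w. \<psi> (polar v w), gram2, \<lambda>v w. \<psi> (polar v (conjugate v w)),
    \<lambda>v w. \<psi> (cross v w), \<lambda>v w. cross v w 0]"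
  let ?gs = "[\<lambda>v w. T w w v, \<lambda>v w. gram2 w v, \<lambda>v w. \<psi> (polar w (conjugate w v))]"
  have fs: "polyfun2 f \<and> (\<exists>v w. f v w \<noteq> 0)" if "f \<in> set ?fs" for f
    using that polyfuns nonzero_somewhere by auto
  have gs: "polyfun2 g \<and> (\<exists>v w. g v w \<noteq> 0)" if "g \<in> set ?gs" for g
  proof -
    have "\<exists>f\<in>set ?fs. g = (\<lambda>v w. f w v)" using that by auto
    then show ?thesis using fs polyfun2_swap by blast
  qed
  have "\<exists>v w. \<forall>f\<in>set (?fs @ ?gs). f v w \<noteq> 0"
    by (rule polyfun2_common_nonzero) (use fs gs in \<open>simp only: set_append; blast\<close>)
  then obtain v w where "\<forall>f\<in>set (?fs @ ?gs). f v w \<noteq> 0" by blast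
  moreover have "T v w w = T w w v" by (metis T_sym)
  ultimately show ?thesis by (intro that[of v w]) simp_all
qed

text \<open>
  Let \<open>X, Y, m\<close> be the basis of linear forms dual to \<open>v, w, n\<close>, where
  \<open>n\<close> completes a generic pair \<open>v, w\<close>; thus \<open>m\<close> is the cross
  product of \<open>v\<close> and \<open>w\<close> up to a factor. Subtracting \<open>t\<close>
  times the cube of the linear form \<open>polar v w\<close>, with \<open>t\<close> chosen to make
  the mixed second derivative along \<open>v\<close> and \<open>w\<close> vanish, leaves a binary
  cubic in \<open>X, m\<close> plus a binary cubic in \<open>Y, m\<close>. Only the coefficient
  \<open>h\<close> of the cube of \<open>m\<close> is shared, and it may be split as
  \<open>s + (h - s)\<close>. All but finitely many \<open>s\<close> make both binary cubics sums of
  two cubes of admissible linear forms.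
\<close>
lemma sum_of_five_cubes:
  "\<exists>l. (\<forall>r<5. \<psi> (l r) \<noteq> 0) \<and> (\<forall>a. T a a a = (\<Sum>r<5::nat. (\<Sum>i<3. l r i * a i) ^ 3))"
proof -
  obtain v w where vw: "T v v w \<noteq> 0" "T v w w \<noteq> 0" "\<psi> (polar v w) \<noteq> 0" "gram2 v w \<noteq> 0" "gram2 w v \<noteq> 0"
    "\<psi> (polar v (conjugate v w)) \<noteq> 0" "\<psi> (polar w (conjugate w v)) \<noteq> 0" "\<psi> (cross v w) \<noteq> 0" "cross v w 0 \<noteq> 0"
    by (rule generic_pair)
  define D where "D = cross v w 0"
  define n :: "nat \<Rightarrow> 'k" where "n = unit_vec 0"
  define X where "X i = (if i = 0 then 0 else if i = 1 then w 2 else - w 1) / D" for i :: nat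
  define Y where "Y i = (if i = 0 then 0 else if i = 1 then - v 2 else v 1) / D" for i :: nat
  define m where "m i = cross v w i / D" for i
  define val where "val L a = (\<Sum>i<3. L i * a i)" for L a :: "nat \<Rightarrow> 'k"
  have D: "D \<noteq> 0" using vw D_def by simp
  have basis: "a i = val X a * v i + val Y a * w i + val m a * n i" if i: "i < 3" for a i
  proof -
    have vals: "val X a = (w 2 * a 1 - w 1 * a 2) / D" "val Y a = (v 1 * a 2 - v 2 * a 1) / D"
      "val m a = (cross v w 0 * a 0 + cross v w 1 * a 1 + cross v w 2 * a 2) / D"
      by (simp_all add: val_def sum_3 X_def Y_def m_def add_divide_distrib diff_divide_distrib)
    have "D * a i = (w 2 * a 1 - w 1 * a 2) * v i + (v 1 * a 2 - v 2 * a 1) * w i +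
        (cross v w 0 * a 0 + cross v w 1 * a 1 + cross v w 2 * a 2) * n i"
    proof -
      consider "i = 0" | "i = 1" | "i = 2" using i by linarith
      then show ?thesis
        by cases (simp_all add: D_def cross_def n_def unit_vec_def algebra_simps)
    qed
    then have "a i = ((w 2 * a 1 - w 1 * a 2) * v i + (v 1 * a 2 - v 2 * a 1) * w i +
        (cross v w 0 * a 0 + cross v w 1 * a 1 + cross v w 2 * a 2) * n i) / D"
      using D by (metis nonzero_mult_div_cancel_left)
    then show ?thesis
      by (simp only: vals times_divide_eq_left add_divide_distrib[symmetric])
  qed
  have expand: "T u u' a = val X a * T u u' v + val Y a * T u u' w + val m a * T u u' n" for u u' a
  proof -
    have "T u u' a = T u u' (\<lambda>i. val X a * v i + val Y a * w i + val m a * n i)"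
      by (rule T_cong) (use basis in auto)
    then show ?thesis by (simp only: T_linear)
  qed
  have polar_eq: "polar u u' i = T u u' v * X i + T u u' w * Y i + T u u' n * m i" if i: "i < 3" for u u' i
  proof -
    have "val L (unit_vec i) = L i" for L
    proof -
      have "val L (unit_vec i) = (\<Sum>k<3. if k = i then L i else 0)"
        unfolding val_def by (intro sum.cong) (auto simp: unit_vec_def)
      then show ?thesis using i by simp
    qed
    then show ?thesis unfolding polar_def by (subst expand) (simp add: mult.commute)
  qed
  define A B C E G where "A = T v v v" and "B = T v v w" and "C = T v w w" and "E = T w w w"
    and "G = T v w n"
  define t where "t = 1 / (B * C)"
  have sym: "T v w v = B" "T w v v = B" "T w v w = C" "T w w v = C" "T w v n = G"
    unfolding B_def C_def G_def by (metis T_sym)+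
  have BC: "B \<noteq> 0" "C \<noteq> 0" using vw by (auto simp: B_def C_def)
  have t: "t * B ^ 2 * C = B" "t * B * C ^ 2 = C" "t * B * C = 1"
    using BC by (simp_all add: t_def power2_eq_square)
  \<comment> \<open>The coefficients of the two binary cubics.  Up to nonzero factors, \<open>b0\<close> and \<open>g0\<close> are
    values of \<open>gram2\<close>, and the points \<open>(b0, b1)\<close> and \<open>(g0, g1)\<close> are the polars of the conjugate vectors.\<close>
  define b0 b1 b2 where "b0 = A - t * B ^ 3" and "b1 = T v v n - t * B ^ 2 * G" and "b2 = T v n n - t * B * G ^ 2"
  define g0 g1 g2 where "g0 = E - t * C ^ 3" and "g1 = T w w n - t * C ^ 2 * G" and "g2 = T w n n - t * C * G ^ 2"
  define h where "h = T n n n - t * G ^ 3"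
  have Cb: "C * b0 = C * A - B ^ 2" "C * b1 = C * T v v n - B * G"
    using BC by (simp_all add: b0_def b1_def t_def power2_eq_square power3_eq_cube right_diff_distrib)
  have Bg: "B * g0 = B * E - C ^ 2" "B * g1 = B * T w w n - C * G"
    using BC by (simp_all add: g0_def g1_def t_def power2_eq_square power3_eq_cube right_diff_distrib)
  have gram2: "gram2 v w = C * b0" "gram2 w v = B * g0"
    unfolding Cb Bg by (simp_all add: gram2_def sym A_def[symmetric] B_def[symmetric] C_def[symmetric] E_def[symmetric] mult.commute)
  have nz: "b0 \<noteq> 0" "g0 \<noteq> 0" using vw gram2 by auto
  have hom: "\<psi> (\<lambda>i. (s * x) * K i + (s * y) * m i) = s ^ e * \<psi> (\<lambda>i. x * K i + y * m i)" for s x y K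
    by (simp add: \<psi>_scale[symmetric] algebra_simps)
  have "\<psi> (polar v (conjugate v w)) = \<psi> (\<lambda>i. (C * b0) * X i + (C * b1) * m i)"
  proof (rule \<psi>_cong)
    fix i :: nat assume "i < 3"
    have *: "T v (conjugate v w) u = C * T v v u - B * T v w u" for u
      unfolding conjugate_eq T_linear by (simp add: B_def C_def)
    show "polar v (conjugate v w) i = (C * b0) * X i + (C * b1) * m i"
      unfolding polar_eq[OF \<open>i < 3\<close>] * Cb
      by (simp add: sym A_def[symmetric] B_def[symmetric] C_def[symmetric] G_def[symmetric] power2_eq_square)
  qed
  then have \<psi>b: "\<psi> (\<lambda>i. b0 * X i + b1 * m i) \<noteq> 0" using vw hom by auto
  have "\<psi> (polar w (conjugate w v)) = \<psi> (\<lambda>i. (B * g0) * Y i + (B * g1) * m i)"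
  proof (rule \<psi>_cong)
    fix i :: nat assume "i < 3"
    have *: "T w (conjugate w v) u = B * T w w u - C * T w v u" for u
      unfolding conjugate_eq T_linear by (simp add: sym)
    show "polar w (conjugate w v) i = (B * g0) * Y i + (B * g1) * m i"
      unfolding polar_eq[OF \<open>i < 3\<close>] * Bg
      by (simp add: sym E_def[symmetric] B_def[symmetric] C_def[symmetric] G_def[symmetric] power2_eq_square)
  qed
  then have \<psi>g: "\<psi> (\<lambda>i. g0 * Y i + g1 * m i) \<noteq> 0" using vw hom by auto
  have \<psi>m: "\<psi> m \<noteq> 0"
  proof -
    have "m = (\<lambda>i. (1 / D) * cross v w i)" by (rule ext) (simp add: m_def)
    then have "\<psi> m = (1 / D) ^ e * \<psi> (cross v w)" by (simp only: \<psi>_scale)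
    then show ?thesis using vw D by simp
  qed
  define good where "good K c0 c1 c2 s \<longleftrightarrow> (\<exists>p1 q1 p2 q2. \<psi> (\<lambda>i. p1 * K i + q1 * m i) \<noteq> 0 \<and>
      \<psi> (\<lambda>i. p2 * K i + q2 * m i) \<noteq> 0 \<and> c0 = p1 ^ 3 + p2 ^ 3 \<and>
      c1 = p1 ^ 2 * q1 + p2 ^ 2 * q2 \<and> c2 = p1 * q1 ^ 2 + p2 * q2 ^ 2 \<and> s = q1 ^ 3 + q2 ^ 3)"
    for K c0 c1 c2 s
  have fin: "finite {s. \<not> good K c0 c1 c2 s}" if "c0 \<noteq> 0" "\<psi> (\<lambda>i. c0 * K i + c1 * m i) \<noteq> 0" for K c0 c1 c2
  proof -
    obtain R where R: "\<And>r. \<psi> (\<lambda>i. K i + r * m i) = poly R r" using \<psi>_line by blast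
    show ?thesis
      unfolding good_def
      by (rule binary_cubic_two_cubes[where \<chi> = "\<lambda>p q. \<psi> (\<lambda>i. p * K i + q * m i)" and e = e and R = R])
        (use that R \<psi>m in \<open>simp_all add: hom\<close>)
  qed
  have "finite ({s. \<not> good X b0 b1 b2 s} \<union> (\<lambda>s. h - s) -` {s. \<not> good Y g0 g1 g2 s})"
    using fin[OF nz(1) \<psi>b] fin[OF nz(2) \<psi>g] by (intro finite_UnI finite_vimageI) (auto simp: inj_def)
  then obtain s where s: "good X b0 b1 b2 s" "good Y g0 g1 g2 (h - s)"
    using ex_new_if_finite[OF infinite_UNIV_char_0] by blast
  obtain p1 q1 p2 q2 where X: "\<psi> (\<lambda>i. p1 * X i + q1 * m i) \<noteq> 0" "\<psi> (\<lambda>i. p2 * X i + q2 * m i) \<noteq> 0"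
      "b0 = p1 ^ 3 + p2 ^ 3" "b1 = p1 ^ 2 * q1 + p2 ^ 2 * q2" "b2 = p1 * q1 ^ 2 + p2 * q2 ^ 2" "s = q1 ^ 3 + q2 ^ 3"
    using s(1) unfolding good_def by blast
  obtain p3 q3 p4 q4 where Y: "\<psi> (\<lambda>i. p3 * Y i + q3 * m i) \<noteq> 0" "\<psi> (\<lambda>i. p4 * Y i + q4 * m i) \<noteq> 0"
      "g0 = p3 ^ 3 + p4 ^ 3" "g1 = p3 ^ 2 * q3 + p4 ^ 2 * q4" "g2 = p3 * q3 ^ 2 + p4 * q4 ^ 2" "h - s = q3 ^ 3 + q4 ^ 3"
    using s(2) unfolding good_def by blast
  obtain \<tau> where \<tau>: "\<tau> ^ 3 = t" using cube_root_exists by blast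
  have "\<tau> \<noteq> 0" using \<tau> t by auto
  define l where "l = (\<lambda>r::nat. if r = 0 then (\<lambda>i. \<tau> * polar v w i)
    else if r = 1 then (\<lambda>i. p1 * X i + q1 * m i) else if r = 2 then (\<lambda>i. p2 * X i + q2 * m i)
    else if r = 3 then (\<lambda>i. p3 * Y i + q3 * m i) else (\<lambda>i. p4 * Y i + q4 * m i))"
  have less_5: "r < 5 \<longleftrightarrow> r = 0 \<or> r = 1 \<or> r = 2 \<or> r = 3 \<or> r = 4" for r :: nat by linarith
  have "\<psi> (\<lambda>i. \<tau> * polar v w i) \<noteq> 0"
    unfolding \<psi>_scale using vw \<open>\<tau> \<noteq> 0\<close> by simp
  then have 1: "\<forall>r<5. \<psi> (l r) \<noteq> 0"
    using X(1,2) Y(1,2) unfolding less_5 by (auto simp: l_def)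
  have 2: "T a a a = (\<Sum>r<5. (\<Sum>i<3. l r i * a i) ^ 3)" for a
  proof -
    define x y z where "x = val X a" and "y = val Y a" and "z = val m a"
    have "T a a a = A * x ^ 3 + 3 * B * x ^ 2 * y + 3 * C * x * y ^ 2 + E * y ^ 3
      + 3 * T v v n * x ^ 2 * z + 6 * G * x * y * z + 3 * T w w n * y ^ 2 * z
      + 3 * T v n n * x * z ^ 2 + 3 * T w n n * y * z ^ 2 + T n n n * z ^ 3"
    proof -
      let ?a = "\<lambda>i. x * v i + y * w i + z * n i"
      have sym': "T v n v = T v v n" "T n v v = T v v n" "T w n w = T w w n" "T n w w = T w w n"
        "T n v n = T v n n" "T n n v = T v n n" "T n w n = T w n n" "T n n w = T w n n"
        "T v n w = G" "T n v w = G" "T n w v = G" "T w n v = G"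
        unfolding G_def by (metis T_sym)+
      have "T a a a = T ?a ?a ?a"
        by (rule T_cong) (use basis in \<open>auto simp: x_def y_def z_def\<close>)
      then show ?thesis
        by (simp add: T_linear sym sym' A_def[symmetric] B_def[symmetric] C_def[symmetric] E_def[symmetric]
            G_def[symmetric] power2_eq_square power3_eq_cube algebra_simps)
    qed
    also have "\<dots> = t * (B * x + C * y + G * z) ^ 3
        + (b0 * x ^ 3 + 3 * b1 * x ^ 2 * z + 3 * b2 * x * z ^ 2 + s * z ^ 3)
        + (g0 * y ^ 3 + 3 * g1 * y ^ 2 * z + 3 * g2 * y * z ^ 2 + (h - s) * z ^ 3)"
    proof -
      have "t * (B * x + C * y + G * z) ^ 3 = t * B ^ 3 * x ^ 3 + 3 * (t * B ^ 2 * C) * x ^ 2 * y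
          + 3 * (t * B * C ^ 2) * x * y ^ 2 + t * C ^ 3 * y ^ 3 + 3 * (t * B ^ 2 * G) * x ^ 2 * z
          + 6 * (t * B * C) * G * x * y * z + 3 * (t * C ^ 2 * G) * y ^ 2 * z
          + 3 * (t * B * G ^ 2) * x * z ^ 2 + 3 * (t * C * G ^ 2) * y * z ^ 2 + t * G ^ 3 * z ^ 3"
        by (simp add: power2_eq_square power3_eq_cube algebra_simps)
      then show ?thesis
        unfolding t b0_def b1_def b2_def g0_def g1_def g2_def h_def
        by (simp add: algebra_simps)
    qed
    also have "\<dots> = (\<tau> * (B * x + C * y + G * z)) ^ 3 + (p1 * x + q1 * z) ^ 3 + (p2 * x + q2 * z) ^ 3
        + (p3 * y + q3 * z) ^ 3 + (p4 * y + q4 * z) ^ 3"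
      unfolding Y(3-6) unfolding X(3-6) \<tau>[symmetric] by (simp add: power2_eq_square power3_eq_cube algebra_simps)
    also have "\<dots> = (\<Sum>r<5. (\<Sum>i<3. l r i * a i) ^ 3)"
    proof -
      have lin: "val (\<lambda>i. x' * K i + y' * m i) a = x' * val K a + y' * z" for x' y' K
        by (simp add: val_def z_def sum_3 algebra_simps)
      have "val (polar v w) a = T v w a"
        using T_expand3[of a v w] by (simp add: val_def polar_def mult.commute)
      also have "\<dots> = B * x + C * y + G * z"
        unfolding expand[of v w a] by (simp add: sym x_def y_def z_def C_def[symmetric] G_def[symmetric])
      finally have "val (polar v w) a = B * x + C * y + G * z" .
      moreover have "val (\<lambda>i. \<tau> * polar v w i) a = \<tau> * val (polar v w) a"
        by (simp add: val_def sum_distrib_left mult.assoc)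
      moreover have "(\<Sum>r<5. (\<Sum>i<3. l r i * a i) ^ 3) = (\<Sum>r<5. val (l r) a ^ 3)"
        by (simp add: val_def)
      moreover have "(\<Sum>r<5. f r) = f 0 + f 1 + f 2 + f 3 + f 4" for f :: "nat \<Rightarrow> 'k"
        by (simp add: eval_nat_numeral add_ac)
      ultimately show ?thesis by (simp add: l_def lin x_def[symmetric] y_def[symmetric])
    qed
    finally show ?thesis .
  qed
  from 1 2 show ?thesis by blast
qed

end

section \<open>The upper bound\<close>

lemma eval_determines_symmetric_cubic:
  assumes "symmetric_array c" "symmetric_array d"
    and eq: "\<And>a. eval a (cubic n c) = eval a (cubic n d)"
    and "i < n" "j < n" "k < n"
  shows "c i j k = d i j k"
proof (rule symmetric_array_eqI[OF assms(1,2) _ assms(4-6)])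
  show "symmetric_array.T n c a a a = symmetric_array.T n d a a a" for a
    using eq[of a] by (simp add: eval_cubic symmetric_array.T_def assms(1,2))
qed

lemma symmetric_array_power_sum: "symmetric_array (\<lambda>i j k. \<Sum>r\<in>R. L r i * L r j * L r k)"
  by unfold_locales (simp_all add: mult_ac)

lemma cubic_power_sum:
  "cubic n (\<lambda>i j k. \<Sum>r\<in>R. L r i * L r j * L r k) = (\<Sum>r\<in>R. linear_form n (L r) ^ 3)"
  by (simp add: cubic_sum linear_form_cubed)

text \<open>
  If \<open>z\<close> is a kernel vector, the cubic is constant along \<open>z\<close>. The change
  of coordinates \<open>g\<close> maps the unit vector number \<open>j\<close> to \<open>z\<close>
  and fixes the others, so the substituted cubic does not involve the variable number
  \<open>j\<close>.
\<close>
lemma (in symmetric_array) kernel_imp_not_essential: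
  assumes z: "\<And>u w. T z u w = 0" and j: "j < n" "z j \<noteq> 0"
  shows "\<not> essentially_depends n (cubic n c)"
proof -
  define y :: "nat \<Rightarrow> 'k mpoly" where "y i = (if i = j then 0 else Var i)" for i
  define \<zeta> :: "nat \<Rightarrow> 'k mpoly" where "\<zeta> i = Const (z i) * Var j" for i
  define g where "g i = y i + \<zeta> i" for i
  define h :: "nat \<Rightarrow> 'k mpoly" where
    "h i = (if i = j then Const (1 / z j) * Var j else Var i + Const (- z i / z j) * Var j)" for i
  have CV: "Const x * Var i \<in> forms n 1" if "i < n" for x :: 'k and i
    using forms_mult[OF Const_in_forms Var_in_forms[OF that]] by simp
  have "\<forall>i<n. g i \<in> forms n 1"
    using j CV Var_in_forms by (auto simp: g_def y_def \<zeta>_def intro!: forms_add)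
  moreover have "\<forall>i<n. h i \<in> forms n 1"
    using j CV Var_in_forms by (auto simp: h_def intro!: forms_add)
  moreover have "subst h (g i) = Var i" for i
  proof (cases "i = j")
    case True
    have "subst h (g i) = Const (z j) * (Const (1 / z j) * Var j)"
      using True by (simp add: g_def y_def \<zeta>_def h_def subst_simps)
    also have "\<dots> = Const (z j * (1 / z j)) * Var j" by (simp only: Const_mult mult.assoc)
    finally show ?thesis using True j by (simp add: Const_one)
  next
    case False
    then have "subst h (g i) = Var i + Const (- z i / z j) * Var j + Const (z i) * (Const (1 / z j) * Var j)"
      by (simp add: g_def y_def \<zeta>_def h_def subst_simps)
    also have "\<dots> = Var i + Const (- z i / z j + z i * (1 / z j)) * Var j"
      by (simp only: Const_mult Const_add distrib_right mult.assoc add.assoc)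
    finally show ?thesis by (simp add: Const_zero)
  qed
  moreover have "subst g (h i) = Var i" for i
  proof (cases "i = j")
    case True
    have "subst g (h i) = Const (1 / z j) * (Const (z j) * Var j)"
      using True by (simp add: g_def y_def \<zeta>_def h_def subst_simps)
    also have "\<dots> = Const (1 / z j * z j) * Var j" by (simp only: Const_mult mult.assoc)
    finally show ?thesis using True j by (simp add: Const_one)
  next
    case False
    then have "subst g (h i) = Var i + Const (z i) * Var j + Const (- z i / z j) * (Const (z j) * Var j)"
      by (simp add: g_def y_def \<zeta>_def h_def subst_simps)
    also have "\<dots> = Var i + Const (z i + - z i / z j * z j) * Var j"
      by (simp only: Const_mult Const_add distrib_right mult.assoc add.assoc)
    finally show ?thesis using j by (simp add: Const_zero)
  qed
  ultimately have lc: "linear_change n g" unfolding linear_change_def by blast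
  define M where "M p q s = (\<Sum>i<n. \<Sum>j<n. \<Sum>k<n. Const (c i j k) * (p i * q j * s k))"
    for p q s :: "nat \<Rightarrow> 'k mpoly"
  have M_add: "M (\<lambda>i. p i + p' i) q s = M p q s + M p' q s" for p p' q s
    by (simp add: M_def algebra_simps sum.distrib)
  have M_swap12: "M p q s = M q p s" for p q s
    unfolding M_def by (subst sum.swap) (simp add: mult_ac sym12)
  have M_swap23: "M p q s = M p s q" for p q s
    unfolding M_def by (rule sum.cong[OF refl], subst sum.swap) (simp add: mult_ac sym23)
  have M_\<zeta>: "M \<zeta> q s = 0" for q s
  proof -
    have c: "(\<Sum>i<n. c i j k * z i) = 0" if "j < n" "k < n" for j k
      using T_expand1[of z "unit_vec j" "unit_vec k"] z that by (simp add: T_unit mult.commute)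
    have "M \<zeta> q s = (\<Sum>j'<n. \<Sum>i<n. \<Sum>k<n. Const (c i j' k) * (\<zeta> i * q j' * s k))"
      unfolding M_def by (rule sum.swap)
    also have "\<dots> = (\<Sum>j'<n. \<Sum>k<n. \<Sum>i<n. Const (c i j' k) * (\<zeta> i * q j' * s k))"
      by (rule sum.cong[OF refl], rule sum.swap)
    also have "\<dots> = (\<Sum>j'<n. \<Sum>k<n. Const (\<Sum>i<n. c i j' k * z i) * (Var j * q j' * s k))"
      unfolding Const_sum Const_mult sum_distrib_right \<zeta>_def
      by (intro sum.cong refl) (simp only: mult_ac)
    also have "\<dots> = 0" by (simp add: c Const_zero)
    finally show ?thesis .
  qed
  have step: "M g q s = M y q s" for q s
    unfolding g_def M_add M_\<zeta> by simp
  have "subst g (cubic n c) = M g g g" by (simp add: subst_cubic M_def)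
  also have "\<dots> = M y y y" by (metis step M_swap12 M_swap23)
  finally have eq: "subst g (cubic n c) = M y y y" .
  have "vars (y i) \<subseteq> {..<n} - {j}" if "i < n" for i
    using that by (auto simp: y_def vars_Var vars_def[of 0])
  then have "vars (subst g (cubic n c)) \<subseteq> {..<n} - {j}"
    unfolding eq M_def by (intro vars_sum_subset vars_mult_subset) (simp_all add: vars_Const)
  then have "card (vars (subst g (cubic n c))) \<le> card ({..<n} - {j})"
    by (intro card_mono) auto
  also have "\<dots> < n" using j by simp
  finally show ?thesis using lc by (auto simp: essentially_depends_def)
qed

text \<open>
  A proper closed homogeneous set lies in the zero set of a single homogeneous polynomial that is
  not identically zero, and avoiding that larger set is enough.
\<close>
lemma Ork_form_le_5:
  fixes F :: "'k::{alg_closed_field,field_char_0} mpoly"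
  assumes F: "F \<in> forms 3 3" and ess: "essentially_depends 3 F"
  shows "Ork_form 3 3 F \<le> 5"
  unfolding Ork_form_def
proof (rule SUP_least)
  fix V :: "'k mpoly set"
  assume "V \<in> {V. V \<subset> forms 3 1 \<and> homogeneous_locus 3 V \<and> zariski_closed 3 V}"
  then obtain P where V: "V \<subset> forms 3 1" and P: "P \<subseteq> (\<Union>e. forms 3 e)" "V = zero_locus 3 P"
    by (auto simp: homogeneous_locus_def)
  obtain l0 where "l0 \<in> forms 3 1" "l0 \<notin> V" using V by blast
  then obtain p where p: "p \<in> P" "eval (lin_coord l0) p \<noteq> 0"
    unfolding P(2) zero_locus_def by blast
  then obtain e where e: "p \<in> forms 3 e" using P by blast
  obtain c where c: "F = cubic 3 c" "\<And>i j k. c i j k = c j i k" "\<And>i j k. c i j k = c i k j"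
    using form_3_eq_symmetric_cubic[OF F] by blast
  interpret symmetric_array 3 c by unfold_locales (rule c(2), rule c(3))
  interpret nondegenerate_ternary_cubic c p e
  proof unfold_locales
    show "z i = 0" if "\<And>u w. T z u w = 0" "i < 3" for z i
    proof (rule ccontr)
      assume "z i \<noteq> 0"
      from kernel_imp_not_essential[OF that this] show False using ess c(1) by simp
    qed
    show "p \<in> forms 3 e" by (rule e)
    show "\<exists>l. eval l p \<noteq> 0" using p by blast
  qed
  obtain L where L: "\<forall>r<5. \<psi> (L r) \<noteq> 0" "\<And>a. T a a a = (\<Sum>r<5::nat. (\<Sum>i<3. L r i * a i) ^ 3)"
    using sum_of_five_cubes by blast
  have "linear_form 3 (L r) \<notin> V" if "r < 5" for r
  proof
    assume "linear_form 3 (L r) \<in> V"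
    then have "\<psi> (lin_coord (linear_form 3 (L r))) = 0"
      using p(1) unfolding P(2) zero_locus_def \<psi>_def by blast
    moreover have "\<psi> (lin_coord (linear_form 3 (L r))) = \<psi> (L r)"
      by (rule \<psi>_cong) (simp add: lin_coord_linear_form)
    ultimately show False using L(1) that by metis
  qed
  then have 1: "\<forall>r<5. linear_form 3 (L r) \<in> forms 3 1 - V"
    using linear_form_in_forms by blast
  let ?d = "\<lambda>i j k. \<Sum>r<5. L r i * L r j * L r k"
  have "eval a (cubic 3 c) = eval a (cubic 3 ?d)" for a
  proof -
    have "eval a (cubic 3 c) = T a a a" by (simp only: eval_cubic T_def)
    also have "\<dots> = eval a (cubic 3 ?d)"
      by (simp only: cubic_power_sum eval_simps eval_linear_form L(2))
    finally show ?thesis .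
  qed
  then have "c i j k = ?d i j k" if "i < 3" "j < 3" "k < 3" for i j k
    by (rule eval_determines_symmetric_cubic[OF symmetric_array_axioms symmetric_array_power_sum _ that])
  then have "F = cubic 3 ?d" unfolding c(1) by (rule cubic_cong)
  then have 2: "F = (\<Sum>r<5. linear_form 3 (L r) ^ 3)" by (simp only: cubic_power_sum)
  have "Ork_avoiding 3 3 F V \<le> enat 5"
    unfolding Ork_avoiding_def
    by (rule INF_lower, intro CollectI exI[of _ "\<lambda>r. linear_form 3 (L r)"] conjI, rule 1, rule 2)
  then show "Ork_avoiding 3 3 F V \<le> 5" by (simp add: numeral_eq_enat)
qed

section \<open>The lower bound\<close>

definition fermat_cubic :: "'k::comm_semiring_1 mpoly" where
  "fermat_cubic = (\<Sum>i<3. Var i ^ 3)"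

lemma fermat_cubic_in_forms: "fermat_cubic \<in> forms 3 3"
  unfolding fermat_cubic_def
  using forms_power[OF Var_in_forms, of _ 3 3] by (auto intro!: forms_sum)

lemma eval_fermat_cubic: "eval a fermat_cubic = (\<Sum>i<3. a i ^ 3)"
  by (simp add: fermat_cubic_def eval_simps)

lemma eval_form_1_add:
  assumes "l \<in> forms n 1"
  shows "eval (\<lambda>i. a i + b i) l = eval a l + eval b l"
  by (subst (1 2 3) form_1_eq_linear_form[OF assms])
    (simp add: eval_linear_form distrib_left sum.distrib)

text \<open>
  If the substituted form does not involve the variable number \<open>j\<close>, then the Fermat
  cubic is constant along the direction \<open>w\<close> that the change of coordinates assigns to
  this variable. At the unit vectors this gives
  \<open>3 t w\<^sub>i + 3 t\<^sup>2 w\<^sub>i\<^sup>2 = 0\<close> for all \<open>t\<close>, hence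
  \<open>w = 0\<close>, which contradicts invertibility.
\<close>
lemma fermat_cubic_essentially_depends:
  "essentially_depends 3 (fermat_cubic :: 'k::field_char_0 mpoly)"
  unfolding essentially_depends_def
proof
  assume "\<exists>g. linear_change 3 g \<and> card (vars (subst g (fermat_cubic :: 'k mpoly))) < 3"
  then obtain g h where g: "\<And>i. i < 3 \<Longrightarrow> g i \<in> forms 3 1" and h: "\<And>i. i < 3 \<Longrightarrow> h i \<in> forms 3 1"
    and inv: "\<And>i. i < 3 \<Longrightarrow> subst h (g i) = Var i" "\<And>i. i < 3 \<Longrightarrow> subst g (h i) = Var i"
    and card: "card (vars (subst g (fermat_cubic :: 'k mpoly))) < 3"
    unfolding linear_change_def by blast
  have "\<not> {..<3} \<subseteq> vars (subst g (fermat_cubic :: 'k mpoly))"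
  proof
    assume "{..<3} \<subseteq> vars (subst g (fermat_cubic :: 'k mpoly))"
    from card_mono[OF finite_vars this] show False using card by simp
  qed
  then obtain j where j: "j < 3" "j \<notin> vars (subst g (fermat_cubic :: 'k mpoly))" by auto
  define w where "w i = eval (unit_vec j) (g i)" for i
  have invariant: "(\<Sum>i<3. (eval a (g i) + t * w i) ^ 3) = (\<Sum>i<3. eval a (g i) ^ 3)" for a t
  proof -
    have "eval (\<lambda>i. a i + t * unit_vec j i) (g i) = eval a (g i) + t * w i" if "i < 3" for i
      using eval_form_1_add[OF g[OF that], of a "\<lambda>i. t * unit_vec j i"]
        eval_scale[OF g[OF that], of t "unit_vec j"] by (simp add: w_def)
    moreover have "eval (\<lambda>i. a i + t * unit_vec j i) (subst g fermat_cubic) = eval a (subst g fermat_cubic)"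
      by (rule eval_cong) (use j in \<open>auto simp: unit_vec_def\<close>)
    ultimately show ?thesis by (simp add: eval_subst eval_fermat_cubic)
  qed
  have w0: "w i = 0" if "i < 3" for i
  proof -
    define b where "b = (\<lambda>k. eval (unit_vec i) (h k))"
    have b: "eval b (g k) = unit_vec i k" if "k < 3" for k
      using arg_cong[OF inv(1)[OF that], of "eval (unit_vec i)"] by (simp add: eval_subst b_def eval_simps)
    have z: "eval (\<lambda>_. 0) (g k) = 0" if "k < 3" for k
      using eval_scale[OF g[OF that], of 0 "\<lambda>_. 0"] by simp
    have 0: "(\<Sum>k<3. (t * w k) ^ 3) = 0" for t
      using invariant[of "\<lambda>_. 0" t] z by simp
    have e: "3 * (t * w i) + 3 * (t * w i) ^ 2 = 0" for t
    proof -
      have "(\<Sum>k<3. (unit_vec i k + t * w k) ^ 3) =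
          (\<Sum>k<3. (t * w k) ^ 3 + (if k = i then (1 + t * w i) ^ 3 - (t * w i) ^ 3 else 0))"
        by (intro sum.cong refl) (auto simp: unit_vec_def)
      also have "\<dots> = (1 + t * w i) ^ 3 - (t * w i) ^ 3"
        using \<open>i < 3\<close> by (simp only: sum.distrib 0 sum.delta) simp
      finally have "(1 + t * w i) ^ 3 - (t * w i) ^ 3 = (\<Sum>k<3. (unit_vec i k :: 'k) ^ 3)"
        using invariant[of b t] b by simp
      also have "\<dots> = (\<Sum>k<3. if k = i then 1 else 0)"
        by (intro sum.cong refl) (auto simp: unit_vec_def)
      also have "\<dots> = 1" using \<open>i < 3\<close> by simp
      finally show ?thesis by (simp add: power2_eq_square power3_eq_cube algebra_simps)
    qed
    have "6 * w i = (3 * (1 * w i) + 3 * (1 * w i) ^ 2) - (3 * (- 1 * w i) + 3 * (- 1 * w i) ^ 2)"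
      by simp
    then have "6 * w i = 0" unfolding e by simp
    then show ?thesis by simp
  qed
  have "eval w (h j) = eval (unit_vec j) (subst g (h j))"
    unfolding eval_subst w_def ..
  also have "\<dots> = 1" using inv(2)[OF j(1)] by (simp add: eval_simps unit_vec_def)
  finally have "eval w (h j) = 1" .
  moreover have "eval w (h j) = eval (\<lambda>i. 0 * w i) (h j)"
    by (rule eval_cong) (use w0 h[OF j(1)] in \<open>auto simp: forms_def polys_def\<close>)
  ultimately show False
    using eval_scale[OF h[OF j(1)], of 0 w] by simp
qed

text \<open>
  With fewer than five summands, the five vectors \<open>(a\<^sub>r\<^sup>2)\<close>,
  \<open>(b\<^sub>r\<^sup>2)\<close>, \<open>(c\<^sub>r\<^sup>2)\<close>,
  \<open>(c\<^sub>r a\<^sub>r)\<close>, \<open>(c\<^sub>r b\<^sub>r)\<close>, formed from the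
  coefficients \<open>a\<^sub>r, b\<^sub>r, c\<^sub>r\<close> of the linear forms, are linearly
  dependent. Pairing the relation with \<open>(a\<^sub>r)\<close>, \<open>(b\<^sub>r)\<close>,
  \<open>(c\<^sub>r)\<close> removes the first three vectors, because these pairings are the
  coefficients of the Fermat cubic. Since \<open>c\<^sub>r \<noteq> 0\<close>, a relation between
  \<open>(a\<^sub>r)\<close> and \<open>(b\<^sub>r)\<close> remains, and pairing it with
  \<open>(a\<^sub>r\<^sup>2)\<close> and \<open>(b\<^sub>r\<^sup>2)\<close> shows that it is
  trivial.
\<close>
lemma fermat_cubic_needs_five_cubes:
  fixes l :: "nat \<Rightarrow> 'k::field_char_0 mpoly"
  assumes l: "\<And>r. r < m \<Longrightarrow> l r \<in> forms 3 1" and c: "\<And>r. r < m \<Longrightarrow> lin_coord (l r) 2 \<noteq> 0"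
    and F: "fermat_cubic = (\<Sum>r<m. l r ^ 3)"
  shows "m \<ge> 5"
proof (rule ccontr)
  assume "\<not> m \<ge> 5"
  then have "m < 5" by simp
  define L where "L r = lin_coord (l r)" for r
  define \<delta> :: "nat \<Rightarrow> nat \<Rightarrow> nat \<Rightarrow> 'k" where "\<delta> i j k = (if i = j \<and> j = k then 1 else 0)" for i j k
  have "fermat_cubic = (\<Sum>r<m. linear_form 3 (L r) ^ 3)"
    unfolding F
  proof (rule sum.cong[OF refl])
    fix r assume "r \<in> {..<m}"
    then show "l r ^ 3 = linear_form 3 (L r) ^ 3"
      using form_1_eq_linear_form[OF l[of r]] by (simp add: L_def)
  qed
  then have F': "fermat_cubic = cubic 3 (\<lambda>i j k. \<Sum>r<m. L r i * L r j * L r k)"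
    by (simp only: cubic_power_sum)
  have S: "(\<Sum>r<m. L r i * L r j * L r k) = \<delta> i j k" if "i < 3" "j < 3" "k < 3" for i j k
  proof (rule eval_determines_symmetric_cubic[OF symmetric_array_power_sum _ _ that])
    show "symmetric_array \<delta>" by unfold_locales (auto simp: \<delta>_def)
    show "eval a (cubic 3 (\<lambda>i j k. \<Sum>r<m. L r i * L r j * L r k)) = eval a (cubic 3 \<delta>)" for a
      unfolding F'[symmetric] eval_fermat_cubic eval_cubic
      by (simp add: sum_3 \<delta>_def power3_eq_cube)
  qed
  define M where "M r j = (if j = 0 then L r 0 * L r 0 else if j = 1 then L r 1 * L r 1
    else if j = 2 then L r 2 * L r 2 else if j = 3 then L r 2 * L r 0 else L r 2 * L r 1)" for r and j :: nat
  have "\<exists>x. (\<exists>j\<in>{..<5}. x j \<noteq> 0) \<and> (\<forall>r<m. (\<Sum>j<5. M r j * x j) = 0)"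
    by (rule underdetermined_system) (use \<open>m < 5\<close> in auto)
  then obtain x where x: "\<exists>j<5. x j \<noteq> 0" and M: "\<And>r. r < m \<Longrightarrow> (\<Sum>j<5. M r j * x j) = 0" by auto
  have rel: "L r 0 * L r 0 * x 0 + L r 1 * L r 1 * x 1 + L r 2 * L r 2 * x 2
      + L r 2 * L r 0 * x 3 + L r 2 * L r 1 * x 4 = 0" if "r < m" for r
    using M[OF that] by (simp add: M_def eval_nat_numeral add_ac)
  have x012: "x i = 0" if "i < 3" for i
  proof -
    have "0 = (\<Sum>r<m. (L r 0 * L r 0 * x 0 + L r 1 * L r 1 * x 1 + L r 2 * L r 2 * x 2
      + L r 2 * L r 0 * x 3 + L r 2 * L r 1 * x 4) * L r i)"
      using rel by (intro sum.neutral[symmetric]) simp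
    also have "\<dots> = x 0 * (\<Sum>r<m. L r 0 * L r 0 * L r i) + x 1 * (\<Sum>r<m. L r 1 * L r 1 * L r i)
      + x 2 * (\<Sum>r<m. L r 2 * L r 2 * L r i) + x 3 * (\<Sum>r<m. L r 2 * L r 0 * L r i)
      + x 4 * (\<Sum>r<m. L r 2 * L r 1 * L r i)"
      by (simp add: sum_distrib_left sum.distrib[symmetric] algebra_simps)
    also have "\<dots> = x i"
    proof -
      consider "i = 0" | "i = 1" | "i = 2" using \<open>i < 3\<close> by linarith
      then show ?thesis by cases (simp_all add: S \<delta>_def del: One_nat_def)
    qed
    finally show ?thesis by simp
  qed
  have rel': "L r 0 * x 3 + L r 1 * x 4 = 0" if "r < m" for r
  proof -
    have "L r 2 * (L r 0 * x 3 + L r 1 * x 4) = 0"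
      using rel[OF that] x012[of 0] x012[of 1] x012[of 2] by (simp add: distrib_left mult.assoc)
    then show ?thesis using c[OF that] by (simp add: L_def)
  qed
  have *: "x 3 * \<delta> i i 0 + x 4 * \<delta> i i 1 = 0" if "i < 3" for i
  proof -
    have "0 = (\<Sum>r<m. L r i * L r i * (L r 0 * x 3 + L r 1 * x 4))"
      using rel' by (intro sum.neutral[symmetric]) simp
    also have "\<dots> = x 3 * (\<Sum>r<m. L r i * L r i * L r 0) + x 4 * (\<Sum>r<m. L r i * L r i * L r 1)"
      by (simp add: sum_distrib_left sum.distrib[symmetric] algebra_simps)
    finally show ?thesis using that by (simp add: S del: One_nat_def)
  qed
  have "x 3 = 0" "x 4 = 0" using *[of 0] *[of 1] by (simp_all add: \<delta>_def)
  moreover have "j = 0 \<or> j = 1 \<or> j = 2 \<or> j = 3 \<or> j = 4" if "j < 5" for j :: nat using that by linarith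
  ultimately show False using x x012[of 0] x012[of 1] x012[of 2] by fastforce
qed

text \<open>
  The closed set is the plane of linear forms without the last variable.
\<close>
lemma Ork_form_fermat_cubic_ge_5: "5 \<le> Ork_form 3 3 (fermat_cubic :: 'k::field_char_0 mpoly)"
proof -
  define V :: "'k mpoly set" where "V = zero_locus 3 {Var 2}"
  have V: "l \<in> V \<longleftrightarrow> l \<in> forms 3 1 \<and> lin_coord l 2 = 0" for l
    by (auto simp: V_def zero_locus_def eval_simps)
  have Var2: "(Var 2 :: 'k mpoly) \<in> forms 3 1" by (rule Var_in_forms) simp
  have "lin_coord (Var 2 :: 'k mpoly) 2 = 1"
    by (simp add: lin_coord_def Var_def)
  then have "Var 2 \<notin> V" using V[of "Var 2"] by simp
  moreover have "V \<subseteq> forms 3 1" unfolding V_def zero_locus_def by blast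
  ultimately have "V \<subset> forms 3 1" using Var2 by blast
  moreover have "homogeneous_locus 3 V"
    unfolding homogeneous_locus_def V_def
    by (rule exI[of _ "{Var 2}"]) (use Var2 in blast)
  moreover have "zariski_closed 3 V"
    unfolding zariski_closed_def V_def
    by (rule exI[of _ "{Var 2}"]) (use Var2 in \<open>simp add: forms_def\<close>)
  ultimately have "V \<in> {V. V \<subset> forms 3 1 \<and> homogeneous_locus 3 V \<and> zariski_closed 3 V}" by blast
  moreover have "5 \<le> Ork_avoiding 3 3 fermat_cubic V"
    unfolding Ork_avoiding_def
  proof (rule INF_greatest)
    fix m :: nat
    assume "m \<in> {m. \<exists>l. (\<forall>i<m. l i \<in> forms 3 1 - V) \<and> fermat_cubic = (\<Sum>i<m. l i ^ 3)}"
    then obtain l where l: "\<forall>i<m. l i \<in> forms 3 1 - V" and F: "fermat_cubic = (\<Sum>i<m. l i ^ 3)"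
      by (elim CollectE exE conjE)
    have "l i \<in> forms 3 1" "lin_coord (l i) 2 \<noteq> 0" if "i < m" for i
      using l that V[of "l i"] by blast+
    then have "m \<ge> 5" using F by (rule fermat_cubic_needs_five_cubes)
    then show "5 \<le> enat m" by (simp add: numeral_eq_enat)
  qed
  ultimately show ?thesis unfolding Ork_form_def by (rule SUP_upper2)
qed

theorem theorem5:
  shows "Ork TYPE('k::{alg_closed_field,field_char_0}) 3 3 = 5"
proof (rule antisym)
  show "Ork TYPE('k) 3 3 \<le> 5"
    unfolding Ork_def by (rule SUP_least) (simp add: Ork_form_le_5)
  show "5 \<le> Ork TYPE('k) 3 3"
    unfolding Ork_def
    by (rule SUP_upper2[of fermat_cubic])
      (simp_all add: fermat_cubic_in_forms fermat_cubic_essentially_depends Ork_form_fermat_cubic_ge_5)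
qed

end
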